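(* Let $\theta,\theta'\in\mathbb{R}$, set $q=e^{i\theta}$, $q'=e^{i\theta'}$, and put $c=e^{\frac14|\theta-\theta'|}$. Then for any pair of $q$-commuting unitaries $U,V$ there exists a pair of $q'$-commuting unitaries $U',V'$ such that $cU',cV'$ dilates $U,V$.
   Context: For $q\in\mathbb{T}$, a pair of unitaries $U,V$ on a Hilbert space is $q$-commuting if $VU=qUV$. A pair $(B_1,B_2)$ of operators on a Hilbert space $\mathcal{K}$ dilates a pair $(A_1,A_2)$ of operators on a Hilbert space $\mathcal{H}$ if $\mathcal{H}\subseteq\mathcal{K}$ (up to an isometric embedding) and $A_i=P_{\mathcal{H}}B_i|_{\mathcal{H}}$ for $i=1,2$, where $P_{\mathcal{H}}$ is the orthogonal projection of $\mathcal{K}$ onto $\mathcal{H}$. *)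

theory Defs
  imports Complex_Main "HOL-Algebra.Algebraic_Closure_Type"
begin

text \<open>
  Hilbert spaces are records with an explicit carrier, so that a statement can quantify
  existentially over them. As types cannot be bound by a quantifier, a Hilbert space asserted to
  exist has to live in some fixed type: for a given \<open>H\<close> over \<open>'a\<close>, the type \<open>nat \<Rightarrow> 'a\<close> is large
  enough to contain the square-summable sequences in \<open>H\<close>, and hence the tensor product of \<open>H\<close> with
  a separable Hilbert space.

  A complex vector space is a \<^locale>\<open>module\<close> over the field of
  complex numbers; the fields \<open>mult\<close> and \<open>one\<close>, which the record of modules inherits from that
  of rings, are not used. The inner product is linear in its first argument.
\<close>

record 'a inner_space = "(complex, 'a) module" +
  inner :: "'a \<Rightarrow> 'a \<Rightarrow> complex"

abbreviation complex_ring :: "complex ring" where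
  "complex_ring \<equiv> ring_of_type_algebra"

definition norm_in :: "('a, 'm) inner_space_scheme \<Rightarrow> 'a \<Rightarrow> real" where
  "norm_in H x = sqrt (Re (inner H x x))"

locale hilbert_space = module complex_ring H
  for H :: "('a, 'm) inner_space_scheme" (structure) +
  assumes inner_add_left:
    "\<lbrakk>x \<in> carrier H; y \<in> carrier H; z \<in> carrier H\<rbrakk>
      \<Longrightarrow> inner H (x \<oplus> y) z = inner H x z + inner H y z"
    and inner_smult_left:
    "\<lbrakk>x \<in> carrier H; y \<in> carrier H\<rbrakk> \<Longrightarrow> inner H (a \<odot>\<^bsub>H\<^esub> x) y = a * inner H x y"
    and inner_commute:
    "\<lbrakk>x \<in> carrier H; y \<in> carrier H\<rbrakk> \<Longrightarrow> inner H x y = cnj (inner H y x)"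
    and inner_nonneg:
    "x \<in> carrier H \<Longrightarrow> 0 \<le> Re (inner H x x)"
    and inner_definite:
    "\<lbrakk>x \<in> carrier H; inner H x x = 0\<rbrakk> \<Longrightarrow> x = \<zero>"
    and complete:
    "\<lbrakk>\<And>n. s n \<in> carrier H;
      \<forall>e>0. \<exists>N. \<forall>m\<ge>N. \<forall>n\<ge>N. norm_in H (s m \<ominus> s n) < e\<rbrakk>
      \<Longrightarrow> \<exists>l\<in>carrier H. (\<lambda>n::nat. norm_in H (s n \<ominus> l)) \<longlonglongrightarrow> 0"

text \<open>
  Maps are total functions on the underlying types; only their values on the carrier matter.
\<close>

definition linear_map ::
  "('a, 'm) inner_space_scheme \<Rightarrow> ('b, 'n) inner_space_scheme \<Rightarrow> ('a \<Rightarrow> 'b) \<Rightarrow> bool" where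
  "linear_map H K A \<longleftrightarrow>
    (\<forall>x\<in>carrier H. A x \<in> carrier K) \<and>
    (\<forall>x\<in>carrier H. \<forall>y\<in>carrier H. A (x \<oplus>\<^bsub>H\<^esub> y) = A x \<oplus>\<^bsub>K\<^esub> A y) \<and>
    (\<forall>a. \<forall>x\<in>carrier H. A (a \<odot>\<^bsub>H\<^esub> x) = a \<odot>\<^bsub>K\<^esub> A x)"

definition bounded_operator :: "('a, 'm) inner_space_scheme \<Rightarrow> ('a \<Rightarrow> 'a) \<Rightarrow> bool" where
  "bounded_operator H A \<longleftrightarrow>
    linear_map H H A \<and> (\<exists>C. \<forall>x\<in>carrier H. norm_in H (A x) \<le> C * norm_in H x)"

definition is_adjoint :: "('a, 'm) inner_space_scheme \<Rightarrow> ('a \<Rightarrow> 'a) \<Rightarrow> ('a \<Rightarrow> 'a) \<Rightarrow> bool" where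
  "is_adjoint H A B \<longleftrightarrow>
    (\<forall>x\<in>carrier H. \<forall>y\<in>carrier H. inner H (A x) y = inner H x (B y))"

definition unitary :: "('a, 'm) inner_space_scheme \<Rightarrow> ('a \<Rightarrow> 'a) \<Rightarrow> bool" where
  "unitary H U \<longleftrightarrow> bounded_operator H U \<and>
    (\<exists>W. bounded_operator H W \<and> is_adjoint H U W \<and>
         (\<forall>x\<in>carrier H. W (U x) = x) \<and> (\<forall>x\<in>carrier H. U (W x) = x))"

definition q_commuting_unitaries ::
  "('a, 'm) inner_space_scheme \<Rightarrow> complex \<Rightarrow> ('a \<Rightarrow> 'a) \<Rightarrow> ('a \<Rightarrow> 'a) \<Rightarrow> bool" where
  "q_commuting_unitaries H q U V \<longleftrightarrow>
    unitary H U \<and> unitary H V \<and> (\<forall>x\<in>carrier H. V (U x) = q \<odot>\<^bsub>H\<^esub> U (V x))"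

definition isometric_embedding ::
  "('a, 'm) inner_space_scheme \<Rightarrow> ('b, 'n) inner_space_scheme \<Rightarrow> ('a \<Rightarrow> 'b) \<Rightarrow> bool" where
  "isometric_embedding H K J \<longleftrightarrow>
    linear_map H K J \<and> (\<forall>x\<in>carrier H. norm_in K (J x) = norm_in H x)"

text \<open>
  The orthogonal projection of \<open>K\<close> onto \<open>S\<close>; it is meaningful for closed subspaces \<open>S\<close>, such as
  the image of a Hilbert space under an isometric embedding.
\<close>

definition orthogonal_projection ::
  "('a, 'm) inner_space_scheme \<Rightarrow> 'a set \<Rightarrow> 'a \<Rightarrow> 'a" where
  "orthogonal_projection K S x =
    (THE y. y \<in> S \<and> (\<forall>z\<in>S. inner K (x \<ominus>\<^bsub>K\<^esub> y) z = 0))"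

definition dilates ::
  "('b, 'n) inner_space_scheme \<Rightarrow> ('b \<Rightarrow> 'b) \<Rightarrow> ('b \<Rightarrow> 'b) \<Rightarrow>
   ('a, 'm) inner_space_scheme \<Rightarrow> ('a \<Rightarrow> 'a) \<Rightarrow> ('a \<Rightarrow> 'a) \<Rightarrow> bool" where
  "dilates K B1 B2 H A1 A2 \<longleftrightarrow>
    bounded_operator K B1 \<and> bounded_operator K B2 \<and>
    bounded_operator H A1 \<and> bounded_operator H A2 \<and>
    (\<exists>J. isometric_embedding H K J \<and>
      (\<forall>x\<in>carrier H.
        J (A1 x) = orthogonal_projection K (J ` carrier H) (B1 (J x)) \<and>
        J (A2 x) = orthogonal_projection K (J ` carrier H) (B2 (J x))))"

end

theory Submission
  imports "HOL-Probability.Characteristic_Functions" Defs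
begin

text \<open>
  If \<open>u, v\<close> are unitaries on a Hilbert space \<open>L\<close> with \<open>q (v u) = q' (u v)\<close>, and \<open>w \<in> L\<close> is a unit vector with
  \<open>\<langle>u w, w\<rangle> = \<langle>v w, w\<rangle> = 1 / c\<close>, then \<open>U \<otimes> u\<close> and \<open>V \<otimes> v\<close> are \<open>q'\<close>-commuting and the compression of their
  multiples by \<open>c\<close> to \<open>H \<otimes> w\<close> is \<open>U, V\<close>. The Weyl unitaries with the Fock vacuum would do; instead,
  \<open>u\<close> and \<open>v\<close> are taken as weighted permutations of an orthonormal basis, so that everything is a
  manipulation of sequences in \<open>H\<close>. For \<open>t = \<theta> - \<theta>'\<close> let \<open>u\<close> be the shift on \<open>\<ell>\<^sup>2(\<int>)\<close>, \<open>v\<close> multiplication by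
  \<open>exp (\<i> t (n + d))\<close> and \<open>w\<close> a Gaussian \<open>exp (- \<bar>t\<bar> (n + d)\<^sup>2 / 2)\<close>. Averaged over the offset \<open>d\<close>, the sums
  become Gaussian integrals and give both expectations the value \<open>exp (- \<bar>t\<bar> / 4)\<close>; hence
  \<open>Re \<langle>u w, w\<rangle> + Re \<langle>v w, w\<rangle> \<ge> 2 exp (- \<bar>t\<bar> / 4)\<close> for some \<open>d\<close>. A symmetrization makes both expectations
  equal to \<open>exp (- \<bar>t\<bar> / 4)\<close>.
\<close>

section \<open>Geometry of Hilbert spaces with a carrier\<close>

context hilbert_space
begin

lemma smult_in [simp, intro]: "x \<in> carrier H \<Longrightarrow> a \<odot>\<^bsub>H\<^esub> x \<in> carrier H"
  using smult_closed[of a x] by (simp add: ring_of_type_algebra_def)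

lemma smult_add_left: "x \<in> carrier H \<Longrightarrow> (a + b) \<odot>\<^bsub>H\<^esub> x = a \<odot>\<^bsub>H\<^esub> x \<oplus> b \<odot>\<^bsub>H\<^esub> x"
  using smult_l_distr[of a b x] by (simp add: ring_of_type_algebra_def)

lemma smult_add_right:
  "x \<in> carrier H \<Longrightarrow> y \<in> carrier H \<Longrightarrow> a \<odot>\<^bsub>H\<^esub> (x \<oplus> y) = a \<odot>\<^bsub>H\<^esub> x \<oplus> a \<odot>\<^bsub>H\<^esub> y"
  using smult_r_distr[of a x y] by (simp add: ring_of_type_algebra_def)

lemma smult_smult: "x \<in> carrier H \<Longrightarrow> a \<odot>\<^bsub>H\<^esub> (b \<odot>\<^bsub>H\<^esub> x) = (a * b) \<odot>\<^bsub>H\<^esub> x"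
  using smult_assoc1[of a b x] by (simp add: ring_of_type_algebra_def)

lemma one_smult [simp]: "x \<in> carrier H \<Longrightarrow> 1 \<odot>\<^bsub>H\<^esub> x = x"
  using smult_one[of x] by (simp add: ring_of_type_algebra_def)

lemma zero_smult [simp]: "x \<in> carrier H \<Longrightarrow> 0 \<odot>\<^bsub>H\<^esub> x = \<zero>"
  using smult_l_null[of x] by (simp add: ring_of_type_algebra_def)

lemma uminus_smult:
  assumes "x \<in> carrier H" shows "\<ominus> x = (-1) \<odot>\<^bsub>H\<^esub> x"
proof -
  have "x \<oplus> (-1) \<odot>\<^bsub>H\<^esub> x = (1 + -1) \<odot>\<^bsub>H\<^esub> x"
    using assms by (simp only: smult_add_left one_smult)
  then show ?thesis
    using assms by (simp add: M.minus_equality M.a_comm)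
qed

lemma minus_smult: "x \<in> carrier H \<Longrightarrow> y \<in> carrier H \<Longrightarrow> x \<ominus> y = x \<oplus> (-1) \<odot>\<^bsub>H\<^esub> y"
  by (simp add: a_minus_def uminus_smult)

lemma inner_add_right:
  "x \<in> carrier H \<Longrightarrow> y \<in> carrier H \<Longrightarrow> z \<in> carrier H
    \<Longrightarrow> inner H x (y \<oplus> z) = inner H x y + inner H x z"
  using inner_commute[of x "y \<oplus> z"] inner_commute[of x y] inner_commute[of x z]
  by (simp add: inner_add_left)

lemma inner_smult_right:
  "x \<in> carrier H \<Longrightarrow> y \<in> carrier H \<Longrightarrow> inner H x (a \<odot>\<^bsub>H\<^esub> y) = cnj a * inner H x y"
  using inner_commute[of x "a \<odot>\<^bsub>H\<^esub> y"] inner_commute[of x y] by (simp add: inner_smult_left)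

lemma inner_minus_left:
  "x \<in> carrier H \<Longrightarrow> y \<in> carrier H \<Longrightarrow> z \<in> carrier H
    \<Longrightarrow> inner H (x \<ominus> y) z = inner H x z - inner H y z"
  by (simp add: minus_smult inner_add_left inner_smult_left)

lemma inner_self:
  assumes "x \<in> carrier H" shows "inner H x x = of_real ((norm_in H x)\<^sup>2)"
proof -
  have "Im (inner H x x) = 0"
    using arg_cong[OF inner_commute[OF assms assms], of Im] by simp
  then show ?thesis
    using inner_nonneg[OF assms] by (simp add: complex_eq_iff norm_in_def)
qed

lemma norm_in_nonneg [simp]: "x \<in> carrier H \<Longrightarrow> 0 \<le> norm_in H x"
  by (simp add: norm_in_def inner_nonneg)

lemma norm_in_eq_0: "x \<in> carrier H \<Longrightarrow> norm_in H x = 0 \<Longrightarrow> x = \<zero>"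
  by (rule inner_definite) (simp_all add: inner_self)

lemma norm_in_smult:
  assumes "x \<in> carrier H" shows "norm_in H (a \<odot>\<^bsub>H\<^esub> x) = cmod a * norm_in H x"
proof -
  have "inner H (a \<odot>\<^bsub>H\<^esub> x) (a \<odot>\<^bsub>H\<^esub> x) = (a * cnj a) * inner H x x"
    using assms by (simp add: inner_smult_left inner_smult_right)
  also have "\<dots> = of_real ((cmod a * norm_in H x)\<^sup>2)"
    using assms by (simp add: inner_self power_mult_distrib flip: complex_norm_square)
  finally have "inner H (a \<odot>\<^bsub>H\<^esub> x) (a \<odot>\<^bsub>H\<^esub> x) = of_real ((cmod a * norm_in H x)\<^sup>2)" .
  then show ?thesis
    using assms by (simp add: norm_in_def[of H "a \<odot>\<^bsub>H\<^esub> x"])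
qed

lemma norm_in_add_sq:
  assumes "x \<in> carrier H" "y \<in> carrier H"
  shows "(norm_in H (x \<oplus> y))\<^sup>2 = (norm_in H x)\<^sup>2 + (norm_in H y)\<^sup>2 + 2 * Re (inner H x y)"
proof -
  have "inner H (x \<oplus> y) (x \<oplus> y) = inner H x x + inner H y y + (inner H x y + cnj (inner H x y))"
    using assms inner_commute[of y x] by (simp add: inner_add_left inner_add_right)
  from arg_cong[OF this, of Re] show ?thesis using assms by (simp add: inner_self)
qed

lemma cauchy_schwarz:
  assumes x: "x \<in> carrier H" and y: "y \<in> carrier H"
  shows "cmod (inner H x y) \<le> norm_in H x * norm_in H y"
proof (cases "norm_in H y = 0")
  case True
  then have "y = 0 \<odot>\<^bsub>H\<^esub> y" using y norm_in_eq_0 by simp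
  then have "inner H x y = 0" using inner_smult_right[OF x y, of 0] by simp
  then show ?thesis using x y by simp
next
  case False
  define n where "n = norm_in H y"
  \<comment> \<open>This coefficient makes \<open>x \<oplus> b \<odot> y\<close> orthogonal to
    \<open>y\<close>. The squared norm of that component of \<open>x\<close> is nonnegative, which
    is the inequality.\<close>
  define b where "b = - inner H x y / of_real (n\<^sup>2)"
  have n: "n > 0" using False norm_in_nonneg[OF y] by (simp add: n_def)
  have "0 \<le> (norm_in H (x \<oplus> b \<odot>\<^bsub>H\<^esub> y))\<^sup>2" by simp
  also have "\<dots> = (norm_in H x)\<^sup>2 + (cmod b * n)\<^sup>2 + 2 * Re (cnj b * inner H x y)"
    using x y by (simp add: norm_in_add_sq norm_in_smult inner_smult_right n_def)
  also have "cnj b * inner H x y = - of_real ((cmod (inner H x y))\<^sup>2 / n\<^sup>2)"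
    using complex_norm_square[of "inner H x y"] by (simp add: b_def mult.commute)
  also have "cmod b * n = cmod (inner H x y) / n"
    using n by (simp add: b_def norm_divide norm_mult power2_eq_square)
  finally have "(cmod (inner H x y))\<^sup>2 \<le> (norm_in H x * n)\<^sup>2"
    using n by (simp add: field_simps power2_eq_square)
  then show ?thesis
    unfolding n_def by (rule power2_le_imp_le) (use x y in simp)
qed

lemma norm_in_triangle:
  assumes "x \<in> carrier H" "y \<in> carrier H"
  shows "norm_in H (x \<oplus> y) \<le> norm_in H x + norm_in H y"
proof (rule power2_le_imp_le)
  have "Re (inner H x y) \<le> norm_in H x * norm_in H y"
    using cauchy_schwarz[OF assms] complex_Re_le_cmod[of "inner H x y"] by linarith
  then show "(norm_in H (x \<oplus> y))\<^sup>2 \<le> (norm_in H x + norm_in H y)\<^sup>2"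
    using assms by (simp add: norm_in_add_sq power2_sum)
qed (use assms in simp)

lemma norm_in_minus_commute:
  assumes "x \<in> carrier H" "y \<in> carrier H"
  shows "norm_in H (x \<ominus> y) = norm_in H (y \<ominus> x)"
proof -
  have "y \<ominus> x = (-1) \<odot>\<^bsub>H\<^esub> (x \<ominus> y)"
    using assms by (simp add: minus_smult smult_add_right smult_smult M.a_comm)
  then show ?thesis using assms by (simp add: norm_in_smult)
qed

lemma norm_in_minus_triangle:
  assumes "x \<in> carrier H" "y \<in> carrier H" "z \<in> carrier H"
  shows "norm_in H (x \<ominus> z) \<le> norm_in H (x \<ominus> y) + norm_in H (y \<ominus> z)"
proof -
  have "(x \<ominus> y) \<oplus> (y \<ominus> z) = x \<oplus> ((\<ominus> y \<oplus> y) \<oplus> \<ominus> z)"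
    using assms by (simp add: a_minus_def M.a_assoc del: M.l_neg)
  then have "x \<ominus> z = (x \<ominus> y) \<oplus> (y \<ominus> z)"
    using assms by (simp add: M.l_neg a_minus_def)
  then show ?thesis using norm_in_triangle[of "x \<ominus> y" "y \<ominus> z"] assms by simp
qed

text \<open>The triangle inequality together with (a - b)^2 \<ge> 0. A bound by a sum of squares is
  what makes square-summability survive addition.\<close>

lemma norm_in_add_sq_le:
  assumes "x \<in> carrier H" "y \<in> carrier H"
  shows "(norm_in H (x \<oplus> y))\<^sup>2 \<le> 2 * (norm_in H x)\<^sup>2 + 2 * (norm_in H y)\<^sup>2"
proof -
  have "(norm_in H (x \<oplus> y))\<^sup>2 \<le> (norm_in H x + norm_in H y)\<^sup>2"
    using norm_in_triangle[OF assms] assms by (intro power_mono) auto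
  moreover have "0 \<le> (norm_in H x - norm_in H y)\<^sup>2" by simp
  ultimately show ?thesis by (simp add: power2_eq_square algebra_simps)
qed

end

section \<open>Square-summable families\<close>

text \<open>A concrete form of the tensor product of \<open>H\<close> with the square-summable
  complex functions on \<open>'i\<close>: a family \<open>f\<close> stands for the sum of the
  \<open>f i\<close> \<otimes> \<open>e_i\<close>, where the \<open>e_i\<close> are the standard
  basis. Summation is unconditional, so that it can be reindexed by any bijection.\<close>

definition ell2 :: "('a, 'm) inner_space_scheme \<Rightarrow> ('i \<Rightarrow> 'a) inner_space" where
  "ell2 H = \<lparr>carrier = {f. (\<forall>i. f i \<in> carrier H) \<and> (\<lambda>i. (norm_in H (f i))\<^sup>2) summable_on UNIV},
     mult = undefined, one = undefined, zero = (\<lambda>i. \<zero>\<^bsub>H\<^esub>), add = (\<lambda>f g i. f i \<oplus>\<^bsub>H\<^esub> g i),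
     smult = (\<lambda>a f i. a \<odot>\<^bsub>H\<^esub> f i), inner = (\<lambda>f g. \<Sum>\<^sub>\<infinity>i. inner H (f i) (g i))\<rparr>"

lemma ell2_carrier:
  "f \<in> carrier (ell2 H) \<longleftrightarrow> (\<forall>i. f i \<in> carrier H) \<and> (\<lambda>i. (norm_in H (f i))\<^sup>2) summable_on UNIV"
  and ell2_zero: "\<zero>\<^bsub>ell2 H\<^esub> = (\<lambda>i. \<zero>\<^bsub>H\<^esub>)"
  and ell2_add: "f \<oplus>\<^bsub>ell2 H\<^esub> g = (\<lambda>i. f i \<oplus>\<^bsub>H\<^esub> g i)"
  and ell2_smult: "a \<odot>\<^bsub>ell2 H\<^esub> f = (\<lambda>i. a \<odot>\<^bsub>H\<^esub> f i)"
  and ell2_inner: "inner (ell2 H) f g = (\<Sum>\<^sub>\<infinity>i. inner H (f i) (g i))"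
  by (simp_all add: ell2_def)

context hilbert_space
begin

lemma ell2_memD: "f \<in> carrier (ell2 H) \<Longrightarrow> f i \<in> carrier H"
  by (simp add: ell2_carrier)

text \<open>Cauchy-Schwarz in \<open>H\<close> and 2ab \<le> a^2 + b^2 bound the terms by a summable
  family.\<close>

lemma ell2_summable:
  assumes "f \<in> carrier (ell2 H)" "g \<in> carrier (ell2 H)"
  shows "(\<lambda>i. inner H (f i) (g i)) summable_on UNIV"
proof (rule abs_summable_summable, rule summable_on_comparison_test)
  show "(\<lambda>i. (norm_in H (f i))\<^sup>2 + (norm_in H (g i))\<^sup>2) summable_on UNIV"
    using assms by (intro summable_on_add) (auto simp: ell2_carrier)
  fix i
  have "0 \<le> norm_in H (f i) * norm_in H (g i)"
    using assms by (simp add: ell2_memD)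
  moreover have "cmod (inner H (f i) (g i)) \<le> norm_in H (f i) * norm_in H (g i)"
    using assms by (intro cauchy_schwarz ell2_memD)
  moreover note sum_squares_bound[of "norm_in H (f i)" "norm_in H (g i)"]
  ultimately show "cmod (inner H (f i) (g i)) \<le> (norm_in H (f i))\<^sup>2 + (norm_in H (g i))\<^sup>2"
    by linarith
qed simp_all

lemma ell2_add_closed:
  assumes "f \<in> carrier (ell2 H)" "g \<in> carrier (ell2 H)"
  shows "f \<oplus>\<^bsub>ell2 H\<^esub> g \<in> carrier (ell2 H)"
  unfolding ell2_carrier
proof (intro conjI allI)
  show "(\<lambda>i. (norm_in H ((f \<oplus>\<^bsub>ell2 H\<^esub> g) i))\<^sup>2) summable_on UNIV"
  proof (rule summable_on_comparison_test)
    show "(\<lambda>i. 2 * (norm_in H (f i))\<^sup>2 + 2 * (norm_in H (g i))\<^sup>2) summable_on UNIV"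
      using assms by (intro summable_on_add summable_on_cmult_right) (auto simp: ell2_carrier)
  qed (use assms in \<open>auto simp: ell2_add ell2_carrier intro!: norm_in_add_sq_le\<close>)
qed (use assms in \<open>auto simp: ell2_add ell2_carrier\<close>)

lemma ell2_smult_closed:
  assumes "f \<in> carrier (ell2 H)"
  shows "a \<odot>\<^bsub>ell2 H\<^esub> f \<in> carrier (ell2 H)"
  using assms by (auto simp: ell2_carrier ell2_smult norm_in_smult power_mult_distrib
      intro!: summable_on_cmult_right)

lemma norm_in_zero [simp]: "norm_in H \<zero> = 0"
  using norm_in_smult[of \<zero> 0] by simp

lemma ell2_abelian_group: "abelian_group (ell2 H :: ('i \<Rightarrow> 'a) inner_space)"
proof (rule abelian_groupI)
  fix f :: "'i \<Rightarrow> 'a" assume f: "f \<in> carrier (ell2 H)"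
  have "(-1) \<odot>\<^bsub>ell2 H\<^esub> f \<oplus>\<^bsub>ell2 H\<^esub> f = \<zero>\<^bsub>ell2 H\<^esub>"
    using ell2_memD[OF f] by (auto simp: ell2_add ell2_smult ell2_zero M.l_neg simp flip: uminus_smult)
  then show "\<exists>g\<in>carrier (ell2 H). g \<oplus>\<^bsub>ell2 H\<^esub> f = \<zero>\<^bsub>ell2 H\<^esub>"
    using ell2_smult_closed[OF f] by blast
next
  show "\<zero>\<^bsub>ell2 H\<^esub> \<in> carrier (ell2 H)"
    by (simp add: ell2_zero ell2_carrier)
next
  fix f g h :: "'i \<Rightarrow> 'a"
  assume "f \<in> carrier (ell2 H)" "g \<in> carrier (ell2 H)" "h \<in> carrier (ell2 H)"
  then show "f \<oplus>\<^bsub>ell2 H\<^esub> g \<oplus>\<^bsub>ell2 H\<^esub> h = f \<oplus>\<^bsub>ell2 H\<^esub> (g \<oplus>\<^bsub>ell2 H\<^esub> h)"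
    by (simp add: ell2_add ell2_memD M.a_assoc)
next
  fix f g :: "'i \<Rightarrow> 'a"
  assume fg: "f \<in> carrier (ell2 H)" "g \<in> carrier (ell2 H)"
  then show "f \<oplus>\<^bsub>ell2 H\<^esub> g \<in> carrier (ell2 H)" by (rule ell2_add_closed)
  show "f \<oplus>\<^bsub>ell2 H\<^esub> g = g \<oplus>\<^bsub>ell2 H\<^esub> f"
    using fg unfolding ell2_add by (intro ext M.a_comm ell2_memD)
  show "\<zero>\<^bsub>ell2 H\<^esub> \<oplus>\<^bsub>ell2 H\<^esub> f = f"
    using fg by (simp add: ell2_add ell2_zero ell2_memD)
qed

lemma ell2_module: "module complex_ring (ell2 H)"
proof (rule moduleI)
  show "cring complex_ring" by (rule cring_from_type_algebra)
qed (auto simp: ell2_abelian_group ell2_smult_closed ring_of_type_algebra_def,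
    auto simp: ell2_add ell2_smult ell2_carrier smult_add_left smult_add_right smult_smult)

lemma ell2_minus:
  assumes "f \<in> carrier (ell2 H)" "g \<in> carrier (ell2 H)"
  shows "f \<ominus>\<^bsub>ell2 H\<^esub> g = (\<lambda>i. f i \<ominus> g i)"
proof -
  interpret K: module complex_ring "ell2 H" by (rule ell2_module)
  have "(-1) \<odot>\<^bsub>ell2 H\<^esub> g \<oplus>\<^bsub>ell2 H\<^esub> g = \<zero>\<^bsub>ell2 H\<^esub>"
    using ell2_memD[OF assms(2)]
    by (auto simp: ell2_add ell2_smult ell2_zero M.l_neg simp flip: uminus_smult)
  then have "\<ominus>\<^bsub>ell2 H\<^esub> g = (-1) \<odot>\<^bsub>ell2 H\<^esub> g"
    using assms ell2_smult_closed by (intro K.M.minus_equality) auto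
  then show ?thesis
    using assms by (simp add: a_minus_def[of "ell2 H"] ell2_add ell2_smult minus_smult ell2_memD)
qed

lemma ell2_inner_self:
  assumes "f \<in> carrier (ell2 H)"
  shows "inner (ell2 H) f f = of_real (\<Sum>\<^sub>\<infinity>i. (norm_in H (f i))\<^sup>2)"
  using assms unfolding ell2_inner
  by (subst infsum_cong[OF inner_self])
    (auto simp: ell2_carrier intro!: infsumI has_sum_of_real has_sum_infsum simp del: of_real_power)

lemma norm_in_ell2:
  assumes "f \<in> carrier (ell2 H)"
  shows "norm_in (ell2 H) f = sqrt (\<Sum>\<^sub>\<infinity>i. (norm_in H (f i))\<^sup>2)"
  using ell2_inner_self[OF assms] by (simp add: norm_in_def[of "ell2 H"])

lemma norm_in_ell2_sq:
  assumes "f \<in> carrier (ell2 H)"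
  shows "(norm_in (ell2 H) f)\<^sup>2 = (\<Sum>\<^sub>\<infinity>i. (norm_in H (f i))\<^sup>2)"
  using assms by (simp add: norm_in_ell2 infsum_nonneg)

section \<open>Completeness of the space of square-summable families\<close>

lemma norm_in_le_ell2:
  assumes "f \<in> carrier (ell2 H)"
  shows "norm_in H (f i) \<le> norm_in (ell2 H) f"
proof (rule power2_le_imp_le)
  show "(norm_in H (f i))\<^sup>2 \<le> (norm_in (ell2 H) f)\<^sup>2"
    using finite_sum_le_infsum[of "\<lambda>i. (norm_in H (f i))\<^sup>2" UNIV "{i}"] assms
    by (simp add: norm_in_ell2_sq ell2_carrier)
  show "0 \<le> norm_in (ell2 H) f" using assms by (simp add: norm_in_ell2 infsum_nonneg)
qed

text \<open>By the reverse triangle inequality the two norms differ by at most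
  \<open>norm_in H (s n \<ominus> l)\<close>.\<close>

lemma tendsto_norm_in_minus:
  assumes s: "\<And>n. s n \<in> carrier H" and l: "l \<in> carrier H" and x: "x \<in> carrier H"
    and lim: "(\<lambda>n. norm_in H (s n \<ominus> l)) \<longlonglongrightarrow> 0"
  shows "(\<lambda>n. norm_in H (x \<ominus> s n)) \<longlonglongrightarrow> norm_in H (x \<ominus> l)"
proof (rule Lim_transform, rule tendsto_const)
  show "(\<lambda>n. norm_in H (x \<ominus> s n) - norm_in H (x \<ominus> l)) \<longlonglongrightarrow> 0"
  proof (rule Lim_null_comparison[OF _ lim], rule always_eventually, rule allI)
    fix n
    show "norm (norm_in H (x \<ominus> s n) - norm_in H (x \<ominus> l)) \<le> norm_in H (s n \<ominus> l)"
      using norm_in_minus_triangle[OF x l s, of n] norm_in_minus_triangle[OF x s l, of n]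
        norm_in_minus_commute[OF l s, of n] by simp
  qed
qed

text \<open>Taking a coordinate does not increase the norm, so the coordinates form Cauchy sequences
  in \<open>H\<close>. Their limits make up the candidate \<open>l\<close>, to which the bounds on
  finite partial sums carry over.\<close>

lemma ell2_complete:
  assumes s: "\<And>n. s n \<in> carrier (ell2 H)"
    and cauchy: "\<forall>e>0. \<exists>N. \<forall>m\<ge>N. \<forall>n\<ge>N. norm_in (ell2 H) (s m \<ominus>\<^bsub>ell2 H\<^esub> s n) < e"
  shows "\<exists>l\<in>carrier (ell2 H). (\<lambda>n::nat. norm_in (ell2 H) (s n \<ominus>\<^bsub>ell2 H\<^esub> l)) \<longlonglongrightarrow> 0"
proof -
  interpret K: module complex_ring "ell2 H" by (rule ell2_module)
  have sH: "s n i \<in> carrier H" for n i using s by (rule ell2_memD)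
  have "\<exists>l\<in>carrier H. (\<lambda>n. norm_in H (s n i \<ominus> l)) \<longlonglongrightarrow> 0" for i
  proof (rule complete[OF sH], intro allI impI)
    fix e :: real assume "e > 0"
    then obtain N where "\<forall>m\<ge>N. \<forall>n\<ge>N. norm_in (ell2 H) (s m \<ominus>\<^bsub>ell2 H\<^esub> s n) < e"
      using cauchy by blast
    moreover have "norm_in H (s m i \<ominus> s n i) \<le> norm_in (ell2 H) (s m \<ominus>\<^bsub>ell2 H\<^esub> s n)" for m n
      using norm_in_le_ell2[OF K.M.minus_closed[OF s s], of m n i] s by (simp add: ell2_minus)
    ultimately show "\<exists>N. \<forall>m\<ge>N. \<forall>n\<ge>N. norm_in H (s m i \<ominus> s n i) < e"
      by (meson le_less_trans)
  qed
  then obtain l where l: "\<And>i. l i \<in> carrier H"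
    and lim: "\<And>i. (\<lambda>n. norm_in H (s n i \<ominus> l i)) \<longlonglongrightarrow> 0"
    by metis
  \<comment> \<open>The Cauchy bound survives the passage from \<open>s n\<close> to
    \<open>l\<close>: first in each finite partial sum, which involves only finitely many convergent
    coordinates, then for the whole sum as a supremum of finite ones.\<close>
  have key: "(\<lambda>i. s m i \<ominus> l i) \<in> carrier (ell2 H) \<and> norm_in (ell2 H) (\<lambda>i. s m i \<ominus> l i) \<le> e"
    if e: "e > 0" and N: "\<forall>n\<ge>N. norm_in (ell2 H) (s m \<ominus>\<^bsub>ell2 H\<^esub> s n) < e" for e m N
  proof -
    have fin: "(\<Sum>i\<in>F. (norm_in H (s m i \<ominus> l i))\<^sup>2) \<le> e\<^sup>2" if F: "finite F" for F
    proof (rule LIMSEQ_le_const2)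
      show "(\<lambda>n. \<Sum>i\<in>F. (norm_in H (s m i \<ominus> s n i))\<^sup>2) \<longlonglongrightarrow> (\<Sum>i\<in>F. (norm_in H (s m i \<ominus> l i))\<^sup>2)"
        by (intro tendsto_intros tendsto_norm_in_minus lim l sH)
      have "(\<Sum>i\<in>F. (norm_in H (s m i \<ominus> s n i))\<^sup>2) \<le> e\<^sup>2" if n: "n \<ge> N" for n
      proof -
        have d: "s m \<ominus>\<^bsub>ell2 H\<^esub> s n \<in> carrier (ell2 H)" using s by simp
        have "(\<Sum>i\<in>F. (norm_in H (s m i \<ominus> s n i))\<^sup>2) \<le> (norm_in (ell2 H) (s m \<ominus>\<^bsub>ell2 H\<^esub> s n))\<^sup>2"
          unfolding norm_in_ell2_sq[OF d] using d F s
          by (intro order_trans[OF _ finite_sum_le_infsum[of _ _ F]]) (auto simp: ell2_carrier ell2_minus)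
        also have "\<dots> \<le> e\<^sup>2"
          using N n d by (intro power_mono) (auto simp: norm_in_ell2 infsum_nonneg less_imp_le)
        finally show ?thesis .
      qed
      then show "\<exists>N. \<forall>n\<ge>N. (\<Sum>i\<in>F. (norm_in H (s m i \<ominus> s n i))\<^sup>2) \<le> e\<^sup>2" by blast
    qed
    have sm: "(\<lambda>i. (norm_in H (s m i \<ominus> l i))\<^sup>2) summable_on UNIV"
      by (rule nonneg_bdd_above_summable_on) (use fin in \<open>auto intro!: bdd_aboveI2\<close>)
    then have c: "(\<lambda>i. s m i \<ominus> l i) \<in> carrier (ell2 H)"
      using sH l by (auto simp: ell2_carrier)
    have "(\<Sum>\<^sub>\<infinity>i. (norm_in H (s m i \<ominus> l i))\<^sup>2) \<le> e\<^sup>2"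
      by (rule infsum_le_finite_sums[OF sm]) (use fin in auto)
    then have "norm_in (ell2 H) (\<lambda>i. s m i \<ominus> l i) \<le> e"
      using e by (simp add: norm_in_ell2[OF c] real_le_lsqrt)
    with c show ?thesis by blast
  qed
  have lK: "l \<in> carrier (ell2 H)"
  proof -
    obtain N where N: "\<forall>m\<ge>N. \<forall>n\<ge>N. norm_in (ell2 H) (s m \<ominus>\<^bsub>ell2 H\<^esub> s n) < 1"
      using cauchy zero_less_one by blast
    then have d: "(\<lambda>i. s N i \<ominus> l i) \<in> carrier (ell2 H)" using key[of 1 N N] by auto
    \<comment> \<open>Writing \<open>l\<close> as the difference of two members of
      \<open>ell2 H\<close> gives its square-summability.\<close>
    have "s N i \<ominus> (s N i \<ominus> l i) = l i" for i
    proof -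
      have "s N i \<ominus> (s N i \<ominus> l i) = (s N i \<oplus> (-1) \<odot>\<^bsub>H\<^esub> s N i) \<oplus> l i"
        using l sH by (simp add: minus_smult smult_add_right smult_smult M.a_assoc)
      also have "\<dots> = l i"
        using l sH by (simp add: M.r_neg flip: uminus_smult)
      finally show ?thesis .
    qed
    then have "s N \<ominus>\<^bsub>ell2 H\<^esub> (\<lambda>i. s N i \<ominus> l i) = l"
      by (simp add: ell2_minus[OF s d])
    then show ?thesis using K.M.minus_closed[OF s[of N] d] by simp
  qed
  moreover have "(\<lambda>n. norm_in (ell2 H) (s n \<ominus>\<^bsub>ell2 H\<^esub> l)) \<longlonglongrightarrow> 0"
  proof (rule LIMSEQ_I)
    fix r :: real assume r: "r > 0"
    then obtain N where N: "\<forall>m\<ge>N. \<forall>n\<ge>N. norm_in (ell2 H) (s m \<ominus>\<^bsub>ell2 H\<^esub> s n) < r / 2"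
      using cauchy half_gt_zero by blast
    have "norm (norm_in (ell2 H) (s n \<ominus>\<^bsub>ell2 H\<^esub> l) - 0) < r" if "n \<ge> N" for n
    proof -
      have "norm_in (ell2 H) (s n \<ominus>\<^bsub>ell2 H\<^esub> l) \<le> r / 2"
        using key[of "r/2" N n] N r that by (auto simp: ell2_minus[OF s lK])
      moreover have "0 \<le> norm_in (ell2 H) (s n \<ominus>\<^bsub>ell2 H\<^esub> l)"
        using s lK by (simp add: norm_in_ell2 infsum_nonneg)
      ultimately show ?thesis using r by simp
    qed
    then show "\<exists>N. \<forall>n\<ge>N. norm (norm_in (ell2 H) (s n \<ominus>\<^bsub>ell2 H\<^esub> l) - 0) < r" by blast
  qed
  ultimately show ?thesis by blast
qed

lemma ell2_hilbert_space: "hilbert_space (ell2 H :: ('i \<Rightarrow> 'a) inner_space)"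
proof -
  interpret K: module complex_ring "ell2 H :: ('i \<Rightarrow> 'a) inner_space" by (rule ell2_module)
  show ?thesis
  proof
    fix f g h :: "'i \<Rightarrow> 'a"
    assume "f \<in> carrier (ell2 H)" "g \<in> carrier (ell2 H)" "h \<in> carrier (ell2 H)"
    then show "inner (ell2 H) (f \<oplus>\<^bsub>ell2 H\<^esub> g) h = inner (ell2 H) f h + inner (ell2 H) g h"
      by (simp add: ell2_inner ell2_add inner_add_left ell2_memD ell2_summable infsum_add)
  next
    fix f g :: "'i \<Rightarrow> 'a" and a
    assume f: "f \<in> carrier (ell2 H)" and g: "g \<in> carrier (ell2 H)"
    show "inner (ell2 H) (a \<odot>\<^bsub>ell2 H\<^esub> f) g = a * inner (ell2 H) f g"
      using f g by (simp add: ell2_inner ell2_smult inner_smult_left ell2_memD infsum_cmult_right')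
    have "(\<lambda>i. inner H (f i) (g i)) = (\<lambda>i. cnj (inner H (g i) (f i)))"
      using f g by (intro ext inner_commute ell2_memD)
    then show "inner (ell2 H) f g = cnj (inner (ell2 H) g f)"
      by (simp add: ell2_inner)
  next
    fix f :: "'i \<Rightarrow> 'a" assume "f \<in> carrier (ell2 H)"
    then show "0 \<le> Re (inner (ell2 H) f f)"
      by (simp add: ell2_inner_self infsum_nonneg)
  next
    fix f :: "'i \<Rightarrow> 'a" assume f: "f \<in> carrier (ell2 H)"
    assume "inner (ell2 H) f f = 0"
    then have "norm_in (ell2 H) f = 0" by (simp add: norm_in_def)
    then have "norm_in H (f i) = 0" for i
      using norm_in_le_ell2[OF f, of i] norm_in_nonneg[OF ell2_memD[OF f]] by (simp add: order_antisym)
    then show "f = \<zero>\<^bsub>ell2 H\<^esub>"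
      using f by (auto simp: ell2_zero ell2_memD norm_in_eq_0)
  qed (rule ell2_complete)
qed

section \<open>Unitaries, isometric embeddings and orthogonal projections\<close>

lemma unitaryE:
  assumes "unitary H U"
  obtains W where "linear_map H H U" "linear_map H H W"
    "\<And>x. x \<in> carrier H \<Longrightarrow> norm_in H (U x) = norm_in H x"
    "\<And>x. x \<in> carrier H \<Longrightarrow> norm_in H (W x) = norm_in H x"
    "\<And>x. x \<in> carrier H \<Longrightarrow> W (U x) = x" "\<And>x. x \<in> carrier H \<Longrightarrow> U (W x) = x"
    "\<And>x y. x \<in> carrier H \<Longrightarrow> y \<in> carrier H \<Longrightarrow> inner H (U x) y = inner H x (W y)"
proof -
  obtain W where W: "bounded_operator H U" "bounded_operator H W" "is_adjoint H U W"
    "\<forall>x\<in>carrier H. W (U x) = x" "\<forall>x\<in>carrier H. U (W x) = x"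
    using assms by (auto simp: unitary_def)
  have lin: "linear_map H H U" "linear_map H H W" using W by (auto simp: bounded_operator_def)
  then have mem: "U x \<in> carrier H" "W x \<in> carrier H" if "x \<in> carrier H" for x
    using that by (auto simp: linear_map_def)
  have n: "norm_in H (U x) = norm_in H x" if "x \<in> carrier H" for x
    using W(3,4) mem that by (simp add: norm_in_def is_adjoint_def)
  have "norm_in H (W x) = norm_in H x" if "x \<in> carrier H" for x
    using n[of "W x"] W(5) mem that by simp
  with that lin n W show thesis by (simp add: is_adjoint_def)
qed

lemma isometryI_bounded:
  assumes "linear_map H H A" "\<And>x. x \<in> carrier H \<Longrightarrow> norm_in H (A x) = norm_in H x"
  shows "bounded_operator H A"
  unfolding bounded_operator_def using assms by (intro conjI exI[of _ 1]) auto

lemma smult_bounded_operator: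
  assumes "bounded_operator H A"
  shows "bounded_operator H (\<lambda>x. a \<odot>\<^bsub>H\<^esub> A x)"
proof -
  obtain C where C: "\<And>x. x \<in> carrier H \<Longrightarrow> norm_in H (A x) \<le> C * norm_in H x"
    and lin: "linear_map H H A"
    using assms by (auto simp: bounded_operator_def)
  have "norm_in H (a \<odot>\<^bsub>H\<^esub> A x) \<le> (cmod a * C) * norm_in H x" if "x \<in> carrier H" for x
    using mult_left_mono[OF C[OF that], of "cmod a"] lin that
    by (simp add: norm_in_smult linear_map_def mult.assoc)
  moreover have "linear_map H H (\<lambda>x. a \<odot>\<^bsub>H\<^esub> A x)"
    using lin by (simp add: linear_map_def smult_add_right smult_smult mult.commute)
  ultimately show ?thesis unfolding bounded_operator_def by blast
qed

text \<open>Polarization: the norms of two vectors and of their sum determine the real part of the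
  inner product; the imaginary part comes from the real part with \<open>\<i> \<odot> x\<close> in
  place of \<open>x\<close>.\<close>

lemma isometric_embedding_inner:
  fixes K :: "('b, 'n) inner_space_scheme"
  assumes K: "hilbert_space K" and J: "isometric_embedding H K J"
    and x: "x \<in> carrier H" and y: "y \<in> carrier H"
  shows "inner K (J x) (J y) = inner H x y"
proof -
  interpret K: hilbert_space K by (rule K)
  have mem: "\<And>x. x \<in> carrier H \<Longrightarrow> J x \<in> carrier K"
    and norm: "\<And>x. x \<in> carrier H \<Longrightarrow> norm_in K (J x) = norm_in H x"
    and add: "\<And>x y. x \<in> carrier H \<Longrightarrow> y \<in> carrier H \<Longrightarrow> J (x \<oplus> y) = J x \<oplus>\<^bsub>K\<^esub> J y"
    and smult: "\<And>a x. x \<in> carrier H \<Longrightarrow> J (a \<odot>\<^bsub>H\<^esub> x) = a \<odot>\<^bsub>K\<^esub> J x"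
    using J by (auto simp: isometric_embedding_def linear_map_def)
  have Re: "Re (inner K (J x) (J y)) = Re (inner H x y)" if "x \<in> carrier H" for x
    using norm_in_add_sq[OF that y] K.norm_in_add_sq[OF mem[OF that] mem[OF y]]
      norm[of "x \<oplus> y"] that y by (simp add: add norm)
  show ?thesis
    using Re[OF x] Re[of "\<i> \<odot>\<^bsub>H\<^esub> x"] x y
    by (simp add: complex_eq_iff smult mem inner_smult_left K.inner_smult_left)
qed

text \<open>The projection is a definite description, so \<open>J z\<close> must be the only
  candidate. For a candidate \<open>J x\<close>, orthogonality pulls back to \<open>H\<close>, where
  \<open>z \<ominus> x\<close> is orthogonal to every vector, itself included, and therefore
  zero.\<close>

lemma orthogonal_projection_eqI:
  fixes K :: "('b, 'n) inner_space_scheme"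
  assumes K: "hilbert_space K" and J: "isometric_embedding H K J"
    and y: "y \<in> carrier K" and z: "z \<in> carrier H"
    and orth: "\<And>w. w \<in> carrier H \<Longrightarrow> inner K y (J w) = inner H z w"
  shows "orthogonal_projection K (J ` carrier H) y = J z"
proof -
  interpret K: hilbert_space K by (rule K)
  have mem: "\<And>x. x \<in> carrier H \<Longrightarrow> J x \<in> carrier K"
    using J by (auto simp: isometric_embedding_def linear_map_def)
  have iff: "(\<forall>w\<in>carrier H. inner K (y \<ominus>\<^bsub>K\<^esub> J x) (J w) = 0) \<longleftrightarrow> x = z"
    if x: "x \<in> carrier H" for x
  proof
    assume *: "\<forall>w\<in>carrier H. inner K (y \<ominus>\<^bsub>K\<^esub> J x) (J w) = 0"
    have "inner H (z \<ominus> x) w = 0" if "w \<in> carrier H" for w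
      using * that x y z
      by (simp add: K.inner_minus_left inner_minus_left mem orth isometric_embedding_inner[OF K J])
    then have "z \<ominus> x = \<zero>" using x z by (intro inner_definite) simp_all
    moreover have "(z \<ominus> x) \<oplus> x = z" using x z by (simp add: a_minus_def M.a_assoc M.l_neg)
    ultimately show "x = z" using x by simp
  next
    assume "x = z"
    then show "\<forall>w\<in>carrier H. inner K (y \<ominus>\<^bsub>K\<^esub> J x) (J w) = 0"
      using y z by (simp add: K.inner_minus_left mem orth isometric_embedding_inner[OF K J])
  qed
  show ?thesis
    unfolding orthogonal_projection_def using iff z by (intro the_equality) auto
qed

end

section \<open>Dilation by weighted permutations\<close>

text \<open>The operator A \<otimes> u on \<open>ell2 H\<close>, where u is the permutation operator
  of \<open>p\<close> with weights \<open>l\<close>.\<close>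

definition weighted_shift ::
  "('a, 'm) inner_space_scheme \<Rightarrow> ('i \<Rightarrow> complex) \<Rightarrow> ('i \<Rightarrow> 'i) \<Rightarrow> ('a \<Rightarrow> 'a) \<Rightarrow> ('i \<Rightarrow> 'a) \<Rightarrow> 'i \<Rightarrow> 'a" where
  "weighted_shift H l p A f = (\<lambda>i. l i \<odot>\<^bsub>H\<^esub> A (f (p i)))"

context hilbert_space
begin

text \<open>Unimodular weights and an isometric \<open>A\<close> keep the norm of each entry, and
  the bijection only reorders the sum.\<close>

lemma weighted_shift_isometry:
  assumes A: "linear_map H H A" and norm: "\<And>x. x \<in> carrier H \<Longrightarrow> norm_in H (A x) = norm_in H x"
    and l: "\<And>i. cmod (l i) = 1" and p: "bij p"
  shows "linear_map (ell2 H) (ell2 H) (weighted_shift H l p A)"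
    and "f \<in> carrier (ell2 H) \<Longrightarrow> norm_in (ell2 H) (weighted_shift H l p A f) = norm_in (ell2 H) f"
proof -
  have eq: "(norm_in H (weighted_shift H l p A f i))\<^sup>2 = (norm_in H (f (p i)))\<^sup>2"
    if "f \<in> carrier (ell2 H)" for f i
    using A norm l ell2_memD[OF that]
    by (simp add: weighted_shift_def norm_in_smult linear_map_def)
  have mem: "weighted_shift H l p A f \<in> carrier (ell2 H)" if "f \<in> carrier (ell2 H)" for f
    using that A unfolding ell2_carrier eq[OF that]
    by (subst summable_on_reindex_bij_betw[OF p]) (auto simp: weighted_shift_def linear_map_def)
  show "linear_map (ell2 H) (ell2 H) (weighted_shift H l p A)"
    using mem A
    by (auto simp: linear_map_def weighted_shift_def ell2_add ell2_smult ell2_memD smult_add_right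
        smult_smult mult.commute)
  show "norm_in (ell2 H) (weighted_shift H l p A f) = norm_in (ell2 H) f"
    if "f \<in> carrier (ell2 H)"
    using that mem by (simp add: norm_in_ell2 eq infsum_reindex_bij_betw[OF p, of "\<lambda>i. (norm_in H (f i))\<^sup>2"])
qed

lemma weighted_shift_unitary:
  fixes p :: "'i \<Rightarrow> 'i"
  assumes U: "unitary H U" and l: "\<And>i. cmod (l i) = 1" and p: "bij p"
  shows "unitary (ell2 H) (weighted_shift H l p U)"
proof -
  interpret K: hilbert_space "ell2 H :: ('i \<Rightarrow> 'a) inner_space" by (rule ell2_hilbert_space)
  obtain W where W: "linear_map H H U" "linear_map H H W"
    "\<And>x. x \<in> carrier H \<Longrightarrow> norm_in H (U x) = norm_in H x"
    "\<And>x. x \<in> carrier H \<Longrightarrow> norm_in H (W x) = norm_in H x"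
    "\<And>x. x \<in> carrier H \<Longrightarrow> W (U x) = x" "\<And>x. x \<in> carrier H \<Longrightarrow> U (W x) = x"
    "\<And>x y. x \<in> carrier H \<Longrightarrow> y \<in> carrier H \<Longrightarrow> inner H (U x) y = inner H x (W y)"
    using unitaryE[OF U] by blast
  \<comment> \<open>Weights of the inverse: solving \<open>g i = l i \<odot> U (f (p i))\<close> for
    \<open>f\<close> moves the conjugate weight to the preimage of the index under
    \<open>p\<close>.\<close>
  define m where "m = (\<lambda>i. cnj (l (inv_into UNIV p i)))"
  have m: "\<And>i. cmod (m i) = 1" using l by (simp add: m_def)
  have p': "bij (inv_into UNIV p)" using p by (rule bij_imp_bij_inv)
  have pp: "p (inv_into UNIV p i) = i" "inv_into UNIV p (p i) = i" for i
    using p by (simp_all add: bij_is_surj surj_f_inv_f bij_is_inj)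
  have unit: "l i * cnj (l i) = 1" "cnj (l i) * l i = 1" for i
    using l[of i] complex_norm_square[of "l i"] by (simp_all add: mult.commute)
  have mem: "U x \<in> carrier H" "W x \<in> carrier H"
    and hom: "U (a \<odot>\<^bsub>H\<^esub> x) = a \<odot>\<^bsub>H\<^esub> U x" "W (a \<odot>\<^bsub>H\<^esub> x) = a \<odot>\<^bsub>H\<^esub> W x"
    if "x \<in> carrier H" for x a
    using that W(1,2) by (auto simp: linear_map_def)
  have "is_adjoint (ell2 H) (weighted_shift H l p U) (weighted_shift H m (inv_into UNIV p) W)"
    unfolding is_adjoint_def
  proof (intro ballI)
    fix f g :: "'i \<Rightarrow> 'a" assume f: "f \<in> carrier (ell2 H)" and g: "g \<in> carrier (ell2 H)"
    have "inner H (weighted_shift H l p U f i) (g i) =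
      inner H (f (p i)) (weighted_shift H m (inv_into UNIV p) W g (p i))" for i
      using ell2_memD[OF f] ell2_memD[OF g]
      by (simp add: weighted_shift_def inner_smult_left inner_smult_right mem W(7) m_def pp)
    then show "inner (ell2 H) (weighted_shift H l p U f) g =
      inner (ell2 H) f (weighted_shift H m (inv_into UNIV p) W g)"
      using infsum_reindex_bij_betw[OF p, of "\<lambda>i. inner H (f i) (weighted_shift H m (inv_into UNIV p) W g i)"]
      by (simp add: ell2_inner)
  qed
  moreover have "weighted_shift H m (inv_into UNIV p) W (weighted_shift H l p U f) = f"
    "weighted_shift H l p U (weighted_shift H m (inv_into UNIV p) W f) = f" if "f \<in> carrier (ell2 H)" for f
    using ell2_memD[OF that]
    by (auto simp: weighted_shift_def fun_eq_iff mem hom W(5,6) smult_smult m_def pp unit)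
  moreover have "bounded_operator (ell2 H) (weighted_shift H l p U)"
    "bounded_operator (ell2 H) (weighted_shift H m (inv_into UNIV p) W)"
    using weighted_shift_isometry[OF W(1,3) l p] weighted_shift_isometry[OF W(2,4) m p']
    by (auto intro!: K.isometryI_bounded)
  ultimately show ?thesis unfolding unitary_def by blast
qed

text \<open>Commuting \<open>U\<close> and \<open>V\<close> produces \<open>q\<close>, which
  \<open>comm\<close> converts into \<open>q'\<close>. The unit vector \<open>w\<close> embeds
  \<open>H\<close> as H \<otimes> w. Compression to this subspace multiplies by the expectation
  \<open>s\<close>, common to both weighted permutations, and \<open>c\<close> cancels it.\<close>

lemma dilation_by_weighted_shifts:
  fixes p1 p2 :: "'i \<Rightarrow> 'i" and l1 l2 w :: "'i \<Rightarrow> complex" and c :: real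
  assumes UV: "q_commuting_unitaries H q U V"
    and p: "bij p1" "bij p2" "\<And>i. p1 (p2 i) = p2 (p1 i)"
    and l: "\<And>i. cmod (l1 i) = 1" "\<And>i. cmod (l2 i) = 1"
    and comm: "\<And>i. q * (l2 i * l1 (p2 i)) = q' * (l1 i * l2 (p1 i))"
    and w: "((\<lambda>i. (cmod (w i))\<^sup>2) has_sum 1) UNIV"
    and w1: "((\<lambda>i. l1 i * w (p1 i) * cnj (w i)) has_sum s) UNIV"
    and w2: "((\<lambda>i. l2 i * w (p2 i) * cnj (w i)) has_sum s) UNIV"
    and s: "c * s = 1"
  shows "\<exists>U' V'. q_commuting_unitaries (ell2 H :: ('i \<Rightarrow> 'a) inner_space) q' U' V' \<and>
    dilates (ell2 H :: ('i \<Rightarrow> 'a) inner_space)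
      (\<lambda>x. complex_of_real c \<odot>\<^bsub>ell2 H\<^esub> U' x) (\<lambda>x. complex_of_real c \<odot>\<^bsub>ell2 H\<^esub> V' x) H U V"
proof -
  let ?K = "ell2 H :: ('i \<Rightarrow> 'a) inner_space"
  interpret K: hilbert_space ?K by (rule ell2_hilbert_space)
  define U' where "U' = weighted_shift H l1 p1 U"
  define V' where "V' = weighted_shift H l2 p2 V"
  define J where "J = (\<lambda>x i. w i \<odot>\<^bsub>H\<^esub> x)"
  have unit: "unitary H U" "unitary H V" and VU: "\<And>x. x \<in> carrier H \<Longrightarrow> V (U x) = q \<odot>\<^bsub>H\<^esub> U (V x)"
    using UV by (auto simp: q_commuting_unitaries_def)
  then have bdd: "bounded_operator H U" "bounded_operator H V"
    by (auto simp: unitary_def)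
  then have mem: "U x \<in> carrier H" "V x \<in> carrier H"
    and hom: "U (a \<odot>\<^bsub>H\<^esub> x) = a \<odot>\<^bsub>H\<^esub> U x" "V (a \<odot>\<^bsub>H\<^esub> x) = a \<odot>\<^bsub>H\<^esub> V x"
    if "x \<in> carrier H" for x a
    using that by (auto simp: bounded_operator_def linear_map_def)
  have unit': "unitary ?K U'" "unitary ?K V'"
    unfolding U'_def V'_def by (intro weighted_shift_unitary unit p l)+
  \<comment> \<open>Both sides evaluate \<open>f\<close> at the same index because \<open>p1\<close>
    and \<open>p2\<close> commute; the scalars agree by \<open>comm\<close>.\<close>
  have comm': "V' (U' f) = q' \<odot>\<^bsub>?K\<^esub> U' (V' f)" if "f \<in> carrier ?K" for f
    using ell2_memD[OF that] comm
    by (simp add: U'_def V'_def weighted_shift_def ell2_smult mem hom VU smult_smult p(3) ac_simps)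
  have qc: "q_commuting_unitaries ?K q' U' V'"
    using unit' comm' by (simp add: q_commuting_unitaries_def)
  have Jsum: "((\<lambda>i. (norm_in H (J x i))\<^sup>2) has_sum (norm_in H x)\<^sup>2) UNIV" if "x \<in> carrier H" for x
    using has_sum_cmult_left[OF w, of "(norm_in H x)\<^sup>2"] that
    by (simp add: J_def norm_in_smult power_mult_distrib)
  have Jmem: "J x \<in> carrier ?K" if "x \<in> carrier H" for x
    using that has_sum_imp_summable[OF Jsum[OF that]] by (auto simp: ell2_carrier J_def)
  have J: "isometric_embedding H ?K J"
    unfolding isometric_embedding_def
  proof (intro conjI ballI)
    show "linear_map H ?K J"
      unfolding linear_map_def using Jmem
      by (auto simp: J_def ell2_add ell2_smult smult_add_right smult_smult mult.commute)
    fix x assume "x \<in> carrier H"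
    then show "norm_in ?K (J x) = norm_in H x"
      by (simp add: norm_in_ell2 Jmem infsumI[OF Jsum])
  qed
  have proj: "orthogonal_projection ?K (J ` carrier H)
      (complex_of_real c \<odot>\<^bsub>?K\<^esub> weighted_shift H l p A (J x)) = J (A x)"
    if A: "linear_map H H A" and x: "x \<in> carrier H" and T: "unitary ?K (weighted_shift H l p A)"
      and sum: "((\<lambda>i. l i * w (p i) * cnj (w i)) has_sum s) UNIV" for A x l p
  proof (rule orthogonal_projection_eqI[OF ell2_hilbert_space J])
    have Ax: "A x \<in> carrier H" "\<And>a. A (a \<odot>\<^bsub>H\<^esub> x) = a \<odot>\<^bsub>H\<^esub> A x"
      using A x by (auto simp: linear_map_def)
    show "A x \<in> carrier H" by fact
    have TJ: "weighted_shift H l p A (J x) \<in> carrier ?K"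
      using T Jmem[OF x] by (auto simp: unitary_def bounded_operator_def linear_map_def)
    then show "complex_of_real c \<odot>\<^bsub>?K\<^esub> weighted_shift H l p A (J x) \<in> carrier ?K"
      by (rule K.smult_in)
    fix v assume v: "v \<in> carrier H"
    \<comment> \<open>The scalars factor out of each entry, so that summing over \<open>i\<close>
      leaves \<open>s\<close> times an inner product in \<open>H\<close>.\<close>
    have "inner H (weighted_shift H l p A (J x) i) (J v i) =
      l i * w (p i) * cnj (w i) * inner H (A x) v" for i
      using x v Ax by (simp add: weighted_shift_def J_def inner_smult_left inner_smult_right)
    then have "inner ?K (weighted_shift H l p A (J x)) (J v) = s * inner H (A x) v"
      using has_sum_cmult_left[OF sum, of "inner H (A x) v"] by (simp add: ell2_inner infsumI)
    then show "inner ?K (complex_of_real c \<odot>\<^bsub>?K\<^esub> weighted_shift H l p A (J x)) (J v) = inner H (A x) v"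
      using K.inner_smult_left[OF TJ Jmem[OF v], of "complex_of_real c"] s
      by (simp flip: mult.assoc of_real_mult)
  qed
  have lin: "linear_map H H U" "linear_map H H V" using bdd by (auto simp: bounded_operator_def)
  have "dilates ?K (\<lambda>x. complex_of_real c \<odot>\<^bsub>?K\<^esub> U' x) (\<lambda>x. complex_of_real c \<odot>\<^bsub>?K\<^esub> V' x) H U V"
    unfolding dilates_def
  proof (intro conjI exI[of _ J] ballI)
    fix x assume x: "x \<in> carrier H"
    show "J (U x) = orthogonal_projection ?K (J ` carrier H) (complex_of_real c \<odot>\<^bsub>?K\<^esub> U' (J x))"
      using proj[OF lin(1) x unit'(1)[unfolded U'_def] w1] by (simp add: U'_def)
    show "J (V x) = orthogonal_projection ?K (J ` carrier H) (complex_of_real c \<odot>\<^bsub>?K\<^esub> V' (J x))"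
      using proj[OF lin(2) x unit'(2)[unfolded V'_def] w2] by (simp add: V'_def)
  qed (use unit' bdd J in \<open>auto simp: unitary_def intro!: K.smult_bounded_operator\<close>)
  with qc show ?thesis by blast
qed

end

section \<open>Gaussian vectors\<close>

text \<open>The real part of the characteristic function of the standard normal distribution,
  rescaled.\<close>

lemma has_bochner_integral_gaussian_cos:
  fixes a b :: real
  assumes a: "0 < a"
  shows "has_bochner_integral lborel (\<lambda>x. cos (b * x) * exp (- a * x\<^sup>2))
    (sqrt (pi / a) * exp (- b\<^sup>2 / (4 * a)))"
proof -
  have std: "has_bochner_integral lborel (\<lambda>x. std_normal_density x * cos (t * x)) (exp (- t\<^sup>2 / 2))" for t
  proof -
    interpret real_distribution std_normal_distribution by (rule real_dist_normal_dist)
    have "complex_of_real (exp (- t\<^sup>2 / 2)) = (CLINT x|std_normal_distribution. iexp (t * x))"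
      using fun_cong[OF char_std_normal_distribution, of t] by (simp add: char_def)
    moreover have int: "complex_integrable std_normal_distribution (\<lambda>x. iexp (t * x))"
      by (rule integrable_iexp) auto
    ultimately have "exp (- t\<^sup>2 / 2) = (LINT x|std_normal_distribution. Re (iexp (t * x)))"
      by (metis Re_complex_of_real integral_Re)
    then have "(LINT x|std_normal_distribution. cos (t * x)) = exp (- t\<^sup>2 / 2)"
      by (simp add: Re_exp)
    moreover have "integrable std_normal_distribution (\<lambda>x. cos (t * x))"
      using integrable_Re[OF int] by (simp add: Re_exp)
    ultimately show ?thesis
      by (simp add: has_bochner_integral_iff integrable_density integral_density)
  qed
  \<comment> \<open>Substituting \<open>r * x\<close> turns the exponent - x^2 / 2 into - a x^2; the
    frequency \<open>b / r\<close> then becomes \<open>b\<close>.\<close>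
  define r where "r = sqrt (2 * a)"
  have r: "r > 0" "r\<^sup>2 = 2 * a" using a by (auto simp: r_def)
  have "has_bochner_integral lborel (\<lambda>x. std_normal_density (0 + r * x) * cos (b / r * (0 + r * x)))
    (exp (- (b / r)\<^sup>2 / 2) /\<^sub>R \<bar>r\<bar>)"
    using std[of "b / r"] r by (subst (asm) lborel_has_bochner_integral_real_affine_iff[of r _ _ 0]) auto
  from has_bochner_integral_mult_right[of "sqrt (2 * pi)", OF this]
  have "has_bochner_integral lborel
     (\<lambda>x. sqrt (2 * pi) * (std_normal_density (0 + r * x) * cos (b / r * (0 + r * x))))
     (sqrt (2 * pi) * (exp (- (b / r)\<^sup>2 / 2) /\<^sub>R \<bar>r\<bar>))" by simp
  moreover have "sqrt (2 * pi) * (std_normal_density (0 + r * x) * cos (b / r * (0 + r * x))) =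
     cos (b * x) * exp (- a * x\<^sup>2)" for x
    using r by (simp add: std_normal_density_def power_mult_distrib)
  moreover have "sqrt (2 * pi) * (exp (- (b / r)\<^sup>2 / 2) /\<^sub>R \<bar>r\<bar>) = sqrt (pi / a) * exp (- b\<^sup>2 / (4 * a))"
    using r a by (simp add: power_divide real_sqrt_mult real_sqrt_divide r_def field_simps)
  ultimately show ?thesis by simp
qed

lemma has_bochner_integral_gaussian:
  fixes a :: real
  assumes "0 < a"
  shows "has_bochner_integral lborel (\<lambda>x. exp (- a * x\<^sup>2)) (sqrt (pi / a))"
  using has_bochner_integral_gaussian_cos[OF assms, of 0] by simp

text \<open>Integrating the periodization of \<open>G\<close> over a period gives the integral of \<open>G\<close>.\<close>

lemma periodization_nonneg_at_some_point:
  fixes G :: "real \<Rightarrow> real"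
  assumes cont: "continuous_on UNIV G" and int: "has_bochner_integral lborel G 0"
    and M: "summable M" "\<And>n x. x \<in> {0..1} \<Longrightarrow> \<bar>G (x + real n) + G (x - real n - 1)\<bar> \<le> M n"
  obtains x where "x \<in> {0..1}" "0 \<le> (\<Sum>n. G (x + real n) + G (x - real n - 1))"
proof -
  define h where "h = (\<lambda>n x. G (x + real n) + G (x - real n - 1))"
  define F where "F = (\<lambda>x. \<Sum>n. h n x)"
  have cont': "continuous_on A G" for A using cont by (rule continuous_on_subset) simp
  have conth: "continuous_on {0..1} (\<lambda>x. \<Sum>n<N. h n x)" for N
    unfolding h_def by (intro continuous_intros continuous_on_compose2[OF cont]) auto
  have intG: "G integrable_on {u..v}" for u v
    by (rule integrable_continuous_interval) (rule cont')
  have hasG: "(G has_integral integral {u..v} G) {u..v}" for u v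
    using intG by (rule integrable_integral)
  \<comment> \<open>Term \<open>n\<close> contributes the unit intervals [n, n + 1] and
    [- n - 1, - n], so the first \<open>N\<close> terms exactly tile [- N, N].\<close>
  have part: "((\<lambda>x. \<Sum>n<N. h n x) has_integral integral {- real N..real N} G) {0..1}" for N
  proof (induction N)
    case (Suc N)
    have 1: "((\<lambda>x. G (x + real N)) has_integral integral {real N..real N + 1} G) {0..1}"
      using has_integral_shift_real_ivl[OF hasG[of "real N" "real N + 1"], of "real N"]
      by simp
    have 2: "((\<lambda>x. G (x - real N - 1)) has_integral integral {- real N - 1..- real N} G) {0..1}"
      using has_integral_shift_real_ivl[OF hasG[of "- real N - 1" "- real N"], of "- real N - 1"]
      by (simp add: algebra_simps)
    have "integral {- real N - 1..- real N} G + integral {- real N..real N} G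
        = integral {- real N - 1..real N} G"
      by (rule Henstock_Kurzweil_Integration.integral_combine[OF _ _ intG]) auto
    moreover have "integral {- real N - 1..real N} G + integral {real N..real N + 1} G
        = integral {- real N - 1..real N + 1} G"
      by (rule Henstock_Kurzweil_Integration.integral_combine[OF _ _ intG]) auto
    ultimately have "integral {- real N..real N} G +
        (integral {real N..real N + 1} G + integral {- real N - 1..- real N} G) =
      integral {- real N - 1..real N + 1} G"
      by linarith
    moreover have "- real N - 1 = - real (Suc N)" "real N + 1 = real (Suc N)" by simp_all
    ultimately have "integral {- real N..real N} G +
        (integral {real N..real N + 1} G + integral {- real N - 1..- real N} G) =
      integral {- real (Suc N)..real (Suc N)} G" by (simp only:)
    with has_integral_add[OF Suc has_integral_add[OF 1 2]] show ?case by (simp add: h_def)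
  qed simp
  \<comment> \<open>Dominated convergence with majorant \<bar>G\<bar> identifies the limit as the
    integral over the line, which is 0.\<close>
  have lim: "(\<lambda>N. integral {- real N..real N} G) \<longlonglongrightarrow> 0"
  proof -
    have "(\<lambda>N. LINT x|lborel. indicator {- real N..real N} x *\<^sub>R G x) \<longlonglongrightarrow> (LINT x|lborel. G x)"
    proof (rule integral_dominated_convergence)
      show "integrable lborel (\<lambda>x. norm (G x))" using int by (auto simp: has_bochner_integral_iff)
      show "AE x in lborel. (\<lambda>N. indicator {- real N..real N} x *\<^sub>R G x) \<longlonglongrightarrow> G x"
      proof (rule AE_I2)
        fix x :: real
        have "eventually (\<lambda>N. indicator {- real N..real N} x *\<^sub>R G x = G x) sequentially"
          using eventually_ge_at_top[of "nat \<lceil>\<bar>x\<bar>\<rceil>"]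
        proof eventually_elim
          case (elim N)
          then have "\<bar>x\<bar> \<le> real N" by linarith
          then show ?case by (auto simp: indicator_def abs_le_iff)
        qed
        then show "(\<lambda>N. indicator {- real N..real N} x *\<^sub>R G x) \<longlonglongrightarrow> G x"
          by (rule tendsto_eventually)
      qed
    qed (use int in \<open>auto simp: has_bochner_integral_iff indicator_def\<close>)
    moreover have "(LINT x|lborel. indicator {- real N..real N} x *\<^sub>R G x) = integral {- real N..real N} G" for N
    proof -
      have "set_integrable lborel {- real N..real N} G"
        by (rule borel_integrable_atLeastAtMost') (rule cont')
      from set_borel_integral_eq_integral(2)[OF this] show ?thesis
        by (simp add: set_lebesgue_integral_def)
    qed
    ultimately show ?thesis using int by (simp add: has_bochner_integral_iff)
  qed
  \<comment> \<open>Uniform convergence carries the integrals to the limit and makes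
    \<open>F\<close> continuous. Hence \<open>F\<close> attains a maximum on the period, and this is
    at least the mean value 0.\<close>
  have ul: "uniform_limit {0..1} (\<lambda>N x. \<Sum>n<N. h n x) F sequentially"
    unfolding F_def by (rule Weierstrass_m_test[OF _ M(1)]) (use M(2) in \<open>simp add: h_def\<close>)
  obtain I J where IJ: "\<And>N. ((\<lambda>x. \<Sum>n<N. h n x) has_integral I N) {0..1}"
    "(F has_integral J) {0..1}" "I \<longlonglongrightarrow> J"
    using uniform_limit_integral[OF ul conth] by auto
  have "I = (\<lambda>N. integral {- real N..real N} G)"
    using has_integral_unique[OF IJ(1) part] by auto
  then have J: "J = 0" using LIMSEQ_unique[OF IJ(3)] lim by simp
  have "continuous_on {0..1} F"
    by (rule uniform_limit_theorem[OF _ ul]) (use conth in auto)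
  then obtain m where m: "m \<in> {0..1}" "\<And>y. y \<in> {0..1} \<Longrightarrow> F y \<le> F m"
    using continuous_attains_sup[of "{0..1::real}" F] by auto
  have "J \<le> F m"
    using has_integral_le[OF IJ(2) has_integral_const_real[of "F m" 0 1] m(2)] by simp
  then show thesis
    using that[OF m(1)] J by (simp add: F_def h_def)
qed

section \<open>Unconditional sums over the integers\<close>

lemma has_sum_int:
  fixes f :: "int \<Rightarrow> 'b::topological_comm_monoid_add"
  assumes "((\<lambda>n. f (int n)) has_sum a) UNIV" "((\<lambda>n. f (- int n - 1)) has_sum b) UNIV"
  shows "(f has_sum (a + b)) UNIV"
proof -
  have 1: "(f has_sum a) {0..}"
    using assms(1) by (subst (asm) has_sum_reindex_bij_witness[of UNIV nat int "{0..}" f _ a a]) auto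
  have 2: "(f has_sum b) {..<0}"
    using assms(2)
    by (subst (asm) has_sum_reindex_bij_witness[of UNIV "\<lambda>k. nat (- k - 1)" "\<lambda>n. - int n - 1" "{..<0}" f _ b b]) auto
  have "{0..} \<union> {..<0} = (UNIV :: int set)" by auto
  moreover have "{0..} \<inter> {..<0} = ({} :: int set)" by auto
  ultimately show ?thesis using has_sum_Un_disjoint[OF 1 2] by simp
qed

text \<open>Absolute summability of both halves allows pairing \<open>n\<close> with
  \<open>- n - 1\<close>, the form in which the periodization is written.\<close>

lemma summable_on_int:
  fixes f :: "int \<Rightarrow> real"
  assumes M: "summable M" "\<And>n. \<bar>f (int n)\<bar> \<le> M n" "\<And>n. \<bar>f (- int n - 1)\<bar> \<le> M n"
  shows "f summable_on UNIV"
    and "infsum f UNIV = (\<Sum>n. f (int n) + f (- int n - 1))"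
proof -
  have 1: "summable (\<lambda>n. norm (f (int n)))" "summable (\<lambda>n. norm (f (- int n - 1)))"
    by (rule summable_comparison_test[OF _ M(1)], use M in auto)+
  then have 2: "summable (\<lambda>n. f (int n))" "summable (\<lambda>n. f (- int n - 1))"
    by (auto intro: summable_norm_cancel)
  have "(f has_sum (suminf (\<lambda>n. f (int n)) + suminf (\<lambda>n. f (- int n - 1)))) UNIV"
    by (intro has_sum_int norm_summable_imp_has_sum 1 summable_sums 2)
  then show "f summable_on UNIV" "infsum f UNIV = (\<Sum>n. f (int n) + f (- int n - 1))"
    using suminf_add[OF 2] by (auto simp: has_sum_imp_summable infsumI)
qed

text \<open>The parabola y^2 lies above its tangent 2 \<bar>y\<bar> - 1, so a geometric sequence
  dominates the Gaussian. The slack 1/2 leaves room for the translate of the Gaussian by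
  1/2.\<close>

lemma gaussian_tail:
  fixes a y :: real
  assumes a: "0 \<le> a" and y: "real n - 1/2 \<le> \<bar>y\<bar>"
  shows "exp (- a * y\<^sup>2) \<le> exp (2 * a) * exp (- a) ^ n"
proof -
  have "0 \<le> (\<bar>y\<bar> - 1)\<^sup>2" by simp
  then have "2 * \<bar>y\<bar> - 1 \<le> y\<^sup>2" by (simp add: power2_eq_square algebra_simps)
  then have "real n - 2 \<le> y\<^sup>2" using y by linarith
  then have "- a * y\<^sup>2 \<le> - a * (real n - 2)" using a by (intro mult_left_mono_neg) auto
  then have "exp (- a * y\<^sup>2) \<le> exp (2 * a + real n * (- a))"
    by (simp add: algebra_simps)
  then show ?thesis by (simp only: exp_add exp_of_nat_mult)
qed

text \<open>The function averaged here is \<open>g x * g (x + 1) + cos (a * x) * (g x)\<^sup>2 - 2 * exp (- a / 4) * (g x)\<^sup>2\<close>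
  with \<open>g x = exp (- a * x\<^sup>2 / 2)\<close>; its integral over the line vanishes.\<close>

lemma gaussian_offset:
  fixes a :: real
  assumes a: "0 < a"
  obtains d where
    "(\<lambda>n::int. exp (- a * (of_int n + d)\<^sup>2)) summable_on UNIV"
    "(\<lambda>n::int. exp (- a * (of_int n + d + 1/2)\<^sup>2)) summable_on UNIV"
    "(\<lambda>n::int. cos (a * (of_int n + d)) * exp (- a * (of_int n + d)\<^sup>2)) summable_on UNIV"
    "2 * exp (- a / 4) * (\<Sum>\<^sub>\<infinity>n::int. exp (- a * (of_int n + d)\<^sup>2)) \<le>
      exp (- a / 4) * (\<Sum>\<^sub>\<infinity>n::int. exp (- a * (of_int n + d + 1/2)\<^sup>2)) +
      (\<Sum>\<^sub>\<infinity>n::int. cos (a * (of_int n + d)) * exp (- a * (of_int n + d)\<^sup>2))"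
proof -
  define s where "s = exp (- a / 4)"
  have s: "0 < s" "s \<le> 1" using a by (auto simp: s_def)
  define g1 where "g1 = (\<lambda>x::real. exp (- a * x\<^sup>2))"
  \<comment> \<open>Up to the factor \<open>s\<close> this is the overlap of neighbouring Gaussian
    values, since x^2 + (x + 1)^2 = 2 (x + 1/2)^2 + 1/2.\<close>
  define g2 where "g2 = (\<lambda>x::real. exp (- a * (x + 1/2)\<^sup>2))"
  define g3 where "g3 = (\<lambda>x::real. cos (a * x) * exp (- a * x\<^sup>2))"
  define G where "G = (\<lambda>x. s * g2 x + g3 x - 2 * s * g1 x)"
  have "has_bochner_integral lborel g2 (sqrt (pi / a))"
    using has_bochner_integral_gaussian[OF a] lborel_has_bochner_integral_real_affine_iff[of 1
        "\<lambda>x. exp (- a * x\<^sup>2)" "sqrt (pi / a)" "1/2"] by (simp add: g2_def add.commute)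
  then have "has_bochner_integral lborel G
      (s * sqrt (pi / a) + sqrt (pi / a) * exp (- a\<^sup>2 / (4 * a)) - 2 * s * sqrt (pi / a))"
    unfolding G_def g1_def g3_def
    by (intro has_bochner_integral_diff has_bochner_integral_add has_bochner_integral_mult_right
        has_bochner_integral_gaussian_cos has_bochner_integral_gaussian a)
  \<comment> \<open>Decay rate and frequency are both \<open>a\<close>, which makes the damping of
    the cosine integral equal to the overlap factor \<open>s\<close>. This is why the three
    integrals cancel.\<close>
  moreover have "exp (- a\<^sup>2 / (4 * a)) = s" using a by (simp add: s_def power2_eq_square)
  ultimately have int: "has_bochner_integral lborel G 0" by simp
  have cont: "continuous_on UNIV G"
    unfolding G_def g1_def g2_def g3_def by (intro continuous_intros)
  define E where "E = (\<lambda>n. exp (2 * a) * exp (- a) ^ n)"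
  have E: "summable E" unfolding E_def using a by (intro summable_mult summable_geometric) auto
  have b1: "\<bar>g1 x\<bar> \<le> E n" if "real n - 1/2 \<le> \<bar>x\<bar>" for x n
    using gaussian_tail[OF less_imp_le[OF a] that] by (simp add: g1_def E_def)
  have b2: "\<bar>g2 x\<bar> \<le> E n" if "real n - 1/2 \<le> \<bar>x + 1/2\<bar>" for x n
    using gaussian_tail[OF less_imp_le[OF a] that] by (simp add: g2_def E_def)
  have b3: "\<bar>g3 x\<bar> \<le> E n" if "real n - 1/2 \<le> \<bar>x\<bar>" for x n
  proof -
    have "\<bar>g3 x\<bar> \<le> 1 * \<bar>g1 x\<bar>"
      unfolding g3_def g1_def abs_mult by (intro mult_right_mono) auto
    with b1[OF that] show ?thesis by simp
  qed
  have bG: "\<bar>G x\<bar> \<le> 4 * E n" if "real n - 1/2 \<le> \<bar>x\<bar>" "real n - 1/2 \<le> \<bar>x + 1/2\<bar>" for x n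
  proof -
    have "\<bar>s * g2 x\<bar> \<le> 1 * E n" "\<bar>s * g1 x\<bar> \<le> 1 * E n"
      unfolding abs_mult using s b1[OF that(1)] b2[OF that(2)] by (intro mult_mono; simp)+
    then show ?thesis unfolding G_def using b3[OF that(1)] by linarith
  qed
  have "\<bar>G (x + real n) + G (x - real n - 1)\<bar> \<le> 8 * E n" if "x \<in> {0..1}" for x n
  proof -
    have "real n - 1/2 \<le> \<bar>x + real n\<bar>" "real n - 1/2 \<le> \<bar>x + real n + 1/2\<bar>"
      by (rule order_trans[OF _ abs_ge_self], use that in simp)+
    moreover have "real n - 1/2 \<le> \<bar>x - real n - 1\<bar>" "real n - 1/2 \<le> \<bar>x - real n - 1 + 1/2\<bar>"
      by (rule order_trans[OF _ abs_ge_minus_self], use that in simp)+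
    ultimately show ?thesis using bG[of n "x + real n"] bG[of n "x - real n - 1"] by linarith
  qed
  then obtain d where d: "d \<in> {0..1}" "0 \<le> (\<Sum>n. G (d + real n) + G (d - real n - 1))"
    using periodization_nonneg_at_some_point[OF cont int, of "\<lambda>n. 8 * E n"] E
    by (auto intro: summable_mult)
  \<comment> \<open>Turns the paired series into unconditional sums over the integers, for
    \<open>G\<close> and for each of its three constituents.\<close>
  have sm: "(\<lambda>n::int. f (of_int n + d)) summable_on UNIV"
    "(\<Sum>\<^sub>\<infinity>n::int. f (of_int n + d)) = (\<Sum>n. f (d + real n) + f (d - real n - 1))"
    if "\<And>n x. real n - 1/2 \<le> \<bar>x\<bar> \<Longrightarrow> real n - 1/2 \<le> \<bar>x + 1/2\<bar> \<Longrightarrow> \<bar>f x\<bar> \<le> 4 * E n" for f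
  proof -
    have "\<bar>f (of_int (int n) + d)\<bar> \<le> 4 * E n" for n
      by (rule that; rule order_trans[OF _ abs_ge_self], use d(1) in simp)
    moreover have "\<bar>f (of_int (- int n - 1) + d)\<bar> \<le> 4 * E n" for n
      by (rule that; rule order_trans[OF _ abs_ge_minus_self], use d(1) in simp)
    ultimately have *: "\<bar>f (of_int (int n) + d)\<bar> \<le> 4 * E n"
      "\<bar>f (of_int (- int n - 1) + d)\<bar> \<le> 4 * E n" for n
      by blast+
    note summable_on_int[of "\<lambda>n. 4 * E n" "\<lambda>n. f (of_int n + d)", OF summable_mult[OF E] *]
    then show "(\<lambda>n::int. f (of_int n + d)) summable_on UNIV"
      "(\<Sum>\<^sub>\<infinity>n::int. f (of_int n + d)) = (\<Sum>n. f (d + real n) + f (d - real n - 1))"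
      by (simp_all add: algebra_simps)
  qed
  have E0: "0 \<le> E n" for n by (simp add: E_def)
  have *: "\<bar>g1 x\<bar> \<le> 4 * E n" "\<bar>g2 x\<bar> \<le> 4 * E n" "\<bar>g3 x\<bar> \<le> 4 * E n"
    if "real n - 1/2 \<le> \<bar>x\<bar>" "real n - 1/2 \<le> \<bar>x + 1/2\<bar>" for x n
    using b1[OF that(1)] b2[OF that(2)] b3[OF that(1)] E0[of n] by linarith+
  have sums: "(\<lambda>n::int. g1 (of_int n + d)) summable_on UNIV"
    "(\<lambda>n::int. g2 (of_int n + d)) summable_on UNIV" "(\<lambda>n::int. g3 (of_int n + d)) summable_on UNIV"
    by (intro sm *; assumption)+
  have "0 \<le> (\<Sum>\<^sub>\<infinity>n::int. G (of_int n + d))"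
    using d(2) sm(2)[of G, OF bG] by simp
  also have "\<dots> = s * (\<Sum>\<^sub>\<infinity>n::int. g2 (of_int n + d)) + (\<Sum>\<^sub>\<infinity>n::int. g3 (of_int n + d))
      + (- 2 * s) * (\<Sum>\<^sub>\<infinity>n::int. g1 (of_int n + d))"
  proof -
    have "G = (\<lambda>x. s * g2 x + g3 x + (- 2 * s) * g1 x)" by (simp add: G_def)
    then show ?thesis
      by (simp only:) (intro infsumI has_sum_add has_sum_cmult_right has_sum_infsum sums)
  qed
  finally have "2 * s * (\<Sum>\<^sub>\<infinity>n::int. g1 (of_int n + d)) \<le>
      s * (\<Sum>\<^sub>\<infinity>n::int. g2 (of_int n + d)) + (\<Sum>\<^sub>\<infinity>n::int. g3 (of_int n + d))"
    by linarith
  with sums show thesis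
    by (intro that[of d]) (simp_all only: g1_def g2_def g3_def s_def)
qed

text \<open>The Gaussian of \<open>gaussian_offset\<close>, normalized. \<open>A\<close> and
  \<open>B\<close> are the expectations of the shift and of the multiplication operator. Only the
  real part of their sum is estimated; a rotation can adjust it afterwards.\<close>

lemma gaussian_vector:
  fixes t :: real
  assumes t: "t \<noteq> 0"
  obtains d :: real and g :: "int \<Rightarrow> real" and A :: real and B :: complex where
    "((\<lambda>n. (g n)\<^sup>2) has_sum 1) UNIV" "((\<lambda>n. g (n + 1) * g n) has_sum A) UNIV"
    "((\<lambda>n. cis (t * (of_int n + d)) * (of_real (g n))\<^sup>2) has_sum B) UNIV"
    "2 * exp (- \<bar>t\<bar> / 4) \<le> Re (of_real A + B)"
proof -
  define a where "a = \<bar>t\<bar>"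
  define s where "s = exp (- a / 4)"
  have a: "0 < a" using t by (simp add: a_def)
  obtain d where d:
    "(\<lambda>n::int. exp (- a * (of_int n + d)\<^sup>2)) summable_on UNIV"
    "(\<lambda>n::int. exp (- a * (of_int n + d + 1/2)\<^sup>2)) summable_on UNIV"
    "(\<lambda>n::int. cos (a * (of_int n + d)) * exp (- a * (of_int n + d)\<^sup>2)) summable_on UNIV"
    "2 * s * (\<Sum>\<^sub>\<infinity>n::int. exp (- a * (of_int n + d)\<^sup>2)) \<le>
      s * (\<Sum>\<^sub>\<infinity>n::int. exp (- a * (of_int n + d + 1/2)\<^sup>2)) +
      (\<Sum>\<^sub>\<infinity>n::int. cos (a * (of_int n + d)) * exp (- a * (of_int n + d)\<^sup>2))"
    using gaussian_offset[OF a] unfolding s_def by blast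
  define N where "N = (\<Sum>\<^sub>\<infinity>n::int. exp (- a * (of_int n + d)\<^sup>2))"
  define S where "S = (\<Sum>\<^sub>\<infinity>n::int. exp (- a * (of_int n + d + 1/2)\<^sup>2))"
  define C where "C = (\<Sum>\<^sub>\<infinity>n::int. cos (a * (of_int n + d)) * exp (- a * (of_int n + d)\<^sup>2))"
  have "0 < exp (- a * (of_int 0 + d)\<^sup>2)" by simp
  also have "\<dots> \<le> N"
    using finite_sum_le_infsum[OF d(1), of "{0}"] by (simp add: N_def)
  finally have N: "0 < N" .
  define g where "g = (\<lambda>n::int. exp (- a * (of_int n + d)\<^sup>2 / 2) / sqrt N)"
  define B where "B = (\<Sum>\<^sub>\<infinity>n. cis (t * (of_int n + d)) * (of_real (g n))\<^sup>2)"
  have sq: "(g n)\<^sup>2 = exp (- a * (of_int n + d)\<^sup>2) * (1 / N)" for n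
    using N by (simp add: g_def power_divide flip: exp_double)
  have g: "((\<lambda>n. (g n)\<^sup>2) has_sum 1) UNIV"
    using has_sum_cmult_left[OF has_sum_infsum[OF d(1)], of "1 / N"] N
    unfolding sq N_def[symmetric] by simp
  have "g (n + 1) * g n = exp (- a * (of_int n + d + 1/2)\<^sup>2) * (s / N)" for n
  proof -
    have "- a * (x + 1)\<^sup>2 / 2 + - a * x\<^sup>2 / 2 = - a * (x + 1/2)\<^sup>2 + - a / 4" for x :: real
    proof -
      have "- a * (x + 1)\<^sup>2 / 2 + - a * x\<^sup>2 / 2 = (- a / 2) * ((x + 1)\<^sup>2 + x\<^sup>2)"
        by (simp add: distrib_left)
      also have "(x + 1)\<^sup>2 + x\<^sup>2 = 2 * (x + 1/2)\<^sup>2 + 1/2"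
        by (simp add: power2_eq_square distrib_left distrib_right)
      finally show ?thesis by (simp add: distrib_left)
    qed
    from this[of "of_int n + d"]
    have "- a * (of_int (n + 1) + d)\<^sup>2 / 2 + - a * (of_int n + d)\<^sup>2 / 2 =
      - a * (of_int n + d + 1/2)\<^sup>2 + - a / 4"
      by (simp add: ac_simps)
    then show ?thesis
      using N by (simp add: g_def s_def flip: exp_add)
  qed
  then have A: "((\<lambda>n. g (n + 1) * g n) has_sum (S * (s / N))) UNIV"
    using has_sum_cmult_left[OF has_sum_infsum[OF d(2)], of "s / N"] by (simp add: S_def)
  have "(\<lambda>n. cis (t * (of_int n + d)) * (of_real (g n))\<^sup>2) summable_on UNIV"
    by (rule abs_summable_summable)
      (use has_sum_imp_summable[OF g] in \<open>simp add: norm_mult norm_power\<close>)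
  then have B: "((\<lambda>n. cis (t * (of_int n + d)) * (of_real (g n))\<^sup>2) has_sum B) UNIV"
    unfolding B_def by (rule has_sum_infsum)
  \<comment> \<open>Cosine is even, so the estimate for \<open>a\<close> = \<bar>t\<bar> applies to
    \<open>t\<close> of either sign.\<close>
  have cos_a: "cos (a * x) = cos (t * x)" for x
    by (cases "t \<ge> 0") (simp_all add: a_def)
  have "((\<lambda>n. cos (t * (of_int n + d)) * (g n)\<^sup>2) has_sum Re B) UNIV"
    using has_sum_Re[OF B] by (simp flip: of_real_power)
  moreover have "((\<lambda>n. cos (t * (of_int n + d)) * (g n)\<^sup>2) has_sum (C * (1 / N))) UNIV"
    using has_sum_cmult_left[OF has_sum_infsum[OF d(3)], of "1 / N"]
    unfolding sq C_def[symmetric] by (simp add: cos_a mult.assoc)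
  ultimately have "Re B = C * (1 / N)" by (rule has_sum_unique)
  moreover have "2 * s * N \<le> s * S + C"
    using d(4) unfolding N_def S_def C_def .
  moreover from calculation(1) have "Re (of_real (S * (s / N)) + B) = (s * S + C) / N"
    by (simp add: add_divide_distrib mult.commute)
  ultimately have "2 * s \<le> Re (of_real (S * (s / N)) + B)"
    using N by (simp only: pos_le_divide_eq)
  with g A B show thesis
    by (intro that[of g "S * (s / N)" d B]) (simp_all add: s_def a_def)
qed

text \<open>Turning the argument of a nonzero \<open>z\<close> into
  \<open>arccos (s / cmod z)\<close> gives the prescribed real part.\<close>

lemma unimodular_rotation:
  fixes z :: complex
  assumes "0 \<le> s" "s \<le> cmod z"
  obtains u where "cmod u = 1" "Re (u * z) = s"
proof (cases "z = 0")
  case True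
  then show thesis using that[of 1] assms by simp
next
  case False
  define u where "u = cis (arccos (s / cmod z) - Arg z)"
  have "u * z = of_real (cmod z) * (cis (arccos (s / cmod z) - Arg z) * cis (Arg z))"
    using rcis_cmod_Arg[of z] by (simp add: u_def rcis_def mult.left_commute flip: mult.assoc)
  also have "\<dots> = of_real (cmod z) * cis (arccos (s / cmod z))"
    by (simp add: cis_mult)
  finally have "Re (u * z) = s"
    using assms False by (simp add: cos_arccos divide_le_eq order_trans[of "-1" 0])
  then show thesis using that[of u] by (simp add: u_def)
qed

section \<open>Symmetrization\<close>

text \<open>The hypotheses of \<open>dilation_by_weighted_shifts\<close> on the second tensor factor
  alone, bundled so that they can be moved to another index type.\<close>

definition intertwining_weights ::
  "complex \<Rightarrow> complex \<Rightarrow> real \<Rightarrow> ('i \<Rightarrow> 'i) \<Rightarrow> ('i \<Rightarrow> 'i) \<Rightarrow> ('i \<Rightarrow> complex) \<Rightarrow> ('i \<Rightarrow> complex) \<Rightarrow>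
   ('i \<Rightarrow> complex) \<Rightarrow> bool" where
  "intertwining_weights q q' s p1 p2 l1 l2 w \<longleftrightarrow>
    bij p1 \<and> bij p2 \<and> (\<forall>i. p1 (p2 i) = p2 (p1 i)) \<and>
    (\<forall>i. cmod (l1 i) = 1) \<and> (\<forall>i. cmod (l2 i) = 1) \<and>
    (\<forall>i. q * (l2 i * l1 (p2 i)) = q' * (l1 i * l2 (p1 i))) \<and>
    ((\<lambda>i. (cmod (w i))\<^sup>2) has_sum 1) UNIV \<and>
    ((\<lambda>i. l1 i * w (p1 i) * cnj (w i)) has_sum s) UNIV \<and>
    ((\<lambda>i. l2 i * w (p2 i) * cnj (w i)) has_sum s) UNIV"

text \<open>Conjugation by \<open>e\<close> relabels the orthonormal basis; the sums are merely
  reindexed.\<close>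

lemma intertwining_weights_transport:
  assumes e: "bij e" and W: "intertwining_weights q q' s p1 p2 l1 l2 w"
  shows "intertwining_weights q q' s (inv_into UNIV e \<circ> p1 \<circ> e) (inv_into UNIV e \<circ> p2 \<circ> e) (l1 \<circ> e) (l2 \<circ> e) (w \<circ> e)"
proof -
  have [simp]: "e (inv_into UNIV e i) = i" for i
    using e by (simp add: bij_is_surj surj_f_inv_f)
  have "bij (inv_into UNIV e \<circ> p1 \<circ> e)" "bij (inv_into UNIV e \<circ> p2 \<circ> e)"
    using W e by (auto simp: intertwining_weights_def intro!: bij_comp bij_imp_bij_inv)
  then show ?thesis
    using W has_sum_reindex_bij_betw[OF e, of "\<lambda>i. (cmod (w i))\<^sup>2"]
      has_sum_reindex_bij_betw[OF e, of "\<lambda>i. l1 i * w (p1 i) * cnj (w i)"]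
      has_sum_reindex_bij_betw[OF e, of "\<lambda>i. l2 i * w (p2 i) * cnj (w i)"]
    by (simp add: intertwining_weights_def)
qed

text \<open>The index type splits into four copies of \<open>'i\<close>, on each of which the sum is
  known.\<close>

lemma has_sum_bool_bool:
  fixes f :: "'i \<times> bool \<times> bool \<Rightarrow> 'b::topological_comm_monoid_add"
  assumes "\<And>x y. ((\<lambda>n. f (n, x, y)) has_sum S x y) UNIV"
  shows "(f has_sum (S False False + S False True + S True False + S True True)) UNIV"
proof -
  have "(f has_sum S (fst z) (snd z)) (range (\<lambda>n. (n, fst z, snd z)))" for z
    using assms[of "fst z" "snd z"] by (subst has_sum_reindex) (auto simp: inj_def o_def)
  then have "(f has_sum (\<Sum>z\<in>UNIV. S (fst z) (snd z))) (\<Union>z. range (\<lambda>n. (n, fst z, snd z)))"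
    by (intro sum_has_sum) auto
  moreover have "(\<Union>z. range (\<lambda>n. (n, fst z, snd z))) = (UNIV :: ('i \<times> bool \<times> bool) set)"
    by force
  moreover have "(\<Sum>z\<in>UNIV. S (fst z) (snd z)) = S False False + S False True + S True False + S True True"
    by (simp add: UNIV_bool add_ac flip: UNIV_Times_UNIV sum.cartesian_product')
  ultimately show ?thesis by simp
qed

text \<open>On \<open>\<ell>\<^sup>2(\<int>)\<close> let \<open>u\<close> be the shift and \<open>v\<close> multiplication by \<open>cis (t * (n + d))\<close>, both times a
  unimodular \<open>z\<close>. The pairs \<open>(u, v)\<close>, \<open>(u\<^sup>*, v\<^sup>*)\<close>, \<open>(v\<^sup>*, u)\<close>, \<open>(v, u\<^sup>*)\<close> satisfy the same commutation
  relation; in the direct sum of all four, both expectations become the mean of \<open>Re \<langle>u\<rangle>\<close> and \<open>Re \<langle>v\<rangle>\<close>,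
  which a suitable \<open>z\<close> makes equal to \<open>exp (- \<bar>t\<bar> / 4)\<close>. In the index \<open>(n, x, y)\<close>, \<open>x\<close> stands for
  exchange and \<open>y\<close> for passage to the adjoint.\<close>

lemma intertwining_weights_gaussian:
  fixes \<theta> \<theta>' :: real
  shows "\<exists>(p1 :: int \<times> bool \<times> bool \<Rightarrow> int \<times> bool \<times> bool) p2 l1 l2 w.
    intertwining_weights (cis \<theta>) (cis \<theta>') (exp (- \<bar>\<theta> - \<theta>'\<bar> / 4)) p1 p2 l1 l2 w"
proof (cases "\<theta> = \<theta>'")
  case True
  \<comment> \<open>With equal angles the identity permutation with weight 1 and a basis vector
    suffice, the required expectation being exp 0 = 1.\<close>
  let ?w = "\<lambda>i. if i = (0, False, False) then 1 else 0 :: complex"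
  have "((\<lambda>i. (cmod (?w i))\<^sup>2) has_sum 1) UNIV" "((\<lambda>i. ?w i * cnj (?w i)) has_sum 1) UNIV"
    by (rule has_sum_finite_neutralI[of "{(0, False, False)}"]; auto)+
  then have "intertwining_weights (cis \<theta>) (cis \<theta>') (exp (- \<bar>\<theta> - \<theta>'\<bar> / 4)) id id (\<lambda>_. 1) (\<lambda>_. 1) ?w"
    using True by (simp add: intertwining_weights_def)
  then show ?thesis by blast
next
  case False
  define t where "t = \<theta> - \<theta>'"
  define s where "s = exp (- \<bar>t\<bar> / 4)"
  have "t \<noteq> 0" using False by (simp add: t_def)
  then obtain d g A B where g: "((\<lambda>n. (g n)\<^sup>2) has_sum 1) UNIV"
    and A: "((\<lambda>n. g (n + 1) * g n) has_sum A) UNIV"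
    and B: "((\<lambda>n. cis (t * (of_int n + d)) * (of_real (g n))\<^sup>2) has_sum B) (UNIV :: int set)"
    and AB: "2 * s \<le> Re (of_real A + B)"
    unfolding s_def by (rule gaussian_vector)
  have "0 \<le> 2 * s" "2 * s \<le> cmod (of_real A + B)"
    using AB complex_Re_le_cmod[of "of_real A + B"] by (auto simp: s_def)
  \<comment> \<open>The Gaussian gives only a lower bound; the common phase \<open>z\<close> brings
    the real part to exactly \<open>2 * s\<close>.\<close>
  then obtain z where z: "cmod z = 1" "Re (z * (of_real A + B)) = 2 * s"
    by (rule unimodular_rotation)
  define D where "D = (\<lambda>n::int. z * cis (t * (of_int n + d)))"
  define p1 where "p1 = (\<lambda>(n::int, x, y). (if x then n else if y then n - 1 else n + 1, x, y))"
  define p2 where "p2 = (\<lambda>(n::int, x, y). (if \<not> x then n else if y then n - 1 else n + 1, x, y))"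
  define l1 where "l1 = (\<lambda>(n, x, y). if x then if y then D n else cnj (D n) else if y then cnj z else z)"
  define l2 where "l2 = (\<lambda>(n, x, y). if x then if y then cnj z else z else if y then cnj (D n) else D n)"
  \<comment> \<open>The factor 1/2 gives each of the four copies the mass 1/4.\<close>
  define w where "w = (\<lambda>(n, x::bool, y::bool). complex_of_real (g n / 2))"
  have
    fwd: "((\<lambda>n. z * (of_real (g (n + 1)) / 2) * (of_real (g n) / 2)) has_sum z * of_real A / 4) UNIV" and
    bwd: "((\<lambda>n. cnj z * (of_real (g (n - 1)) / 2) * (of_real (g n) / 2)) has_sum cnj (z * of_real A) / 4) UNIV" and
    mul: "((\<lambda>n. D n * (of_real (g n) / 2) * (of_real (g n) / 2)) has_sum z * B / 4) UNIV" and
    adj: "((\<lambda>n. cnj (D n) * (of_real (g n) / 2) * (of_real (g n) / 2)) has_sum cnj (z * B) / 4) UNIV"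
  proof -
    show 1: "((\<lambda>n. z * (of_real (g (n + 1)) / 2) * (of_real (g n) / 2)) has_sum z * of_real A / 4) UNIV"
      using has_sum_cmult_right[OF has_sum_of_real[OF A], of "z / 4"] by (simp add: mult.assoc)
    \<comment> \<open>As \<open>g\<close> is real, the adjoint shift yields the conjugate sum, with
      the index moved by one.\<close>
    have "((\<lambda>n. cnj z * (of_real (g (n + 1)) / 2) * (of_real (g n) / 2)) has_sum cnj (z * of_real A) / 4) UNIV"
      using 1 by (subst (asm) has_sum_cnj_iff[symmetric]) simp
    then show "((\<lambda>n. cnj z * (of_real (g (n - 1)) / 2) * (of_real (g n) / 2)) has_sum cnj (z * of_real A) / 4) UNIV"
      by (subst has_sum_reindex_bij_witness[of _ "\<lambda>n. n + 1" "\<lambda>n. n - 1" UNIV _ _ _ "cnj (z * of_real A) / 4"])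
        (auto simp: ac_simps)
    show 2: "((\<lambda>n. D n * (of_real (g n) / 2) * (of_real (g n) / 2)) has_sum z * B / 4) UNIV"
      using has_sum_cmult_right[OF B, of "z / 4"] by (simp add: D_def power2_eq_square mult.assoc)
    then show "((\<lambda>n. cnj (D n) * (of_real (g n) / 2) * (of_real (g n) / 2)) has_sum cnj (z * B) / 4) UNIV"
      by (subst (asm) has_sum_cnj_iff[symmetric]) simp
  qed
  \<comment> \<open>The two conjugate pairs add up to half the real part of
    \<open>z * (A + B)\<close>, which is \<open>s\<close>.\<close>
  have mean: "z * of_real A / 4 + cnj (z * of_real A) / 4 + cnj (z * B) / 4 + z * B / 4 = of_real s"
    using z(2) by (simp add: complex_eq_iff field_simps)
  have "bij p1"
    by (rule o_bij[of "\<lambda>(n, x, y). (if x then n else if y then n + 1 else n - 1, x, y)"])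
      (auto simp: p1_def fun_eq_iff)
  moreover have "bij p2"
    by (rule o_bij[of "\<lambda>(n, x, y). (if \<not> x then n else if y then n + 1 else n - 1, x, y)"])
      (auto simp: p2_def fun_eq_iff)
  moreover have "p1 (p2 i) = p2 (p1 i)" for i
    by (cases i) (simp add: p1_def p2_def)
  moreover have "cmod (l1 i) = 1" "cmod (l2 i) = 1" for i
    using z(1) by (cases i; simp add: l1_def l2_def D_def norm_mult)+
  \<comment> \<open>One step of the shift multiplies \<open>D\<close> by \<open>cis t\<close> or its
    conjugate, and \<open>cis t\<close> is the quotient of the two commutation factors. The phase
    \<open>z\<close> enters both sides equally.\<close>
  moreover have "cis \<theta> * (l2 i * l1 (p2 i)) = cis \<theta>' * (l1 i * l2 (p1 i))" for i
  proof -
    have q: "cis \<theta> = cis \<theta>' * cis t" by (simp add: cis_mult t_def)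
    have D: "D (n + 1) = D n * cis t" "D (n - 1) = D n * cnj (cis t)" for n
      by (simp_all add: D_def cis_mult cis_cnj algebra_simps)
    have c: "cis t * cnj (cis t) = 1" by (simp add: cis_cnj cis_mult)
    then have c': "cis t * (cnj (cis t) * x) = x" for x by (simp flip: mult.assoc)
    obtain n x y where i: "i = (n, x, y)" by (cases i)
    show ?thesis
      unfolding i q by (cases x; cases y) (simp_all add: l1_def l2_def p1_def p2_def D c c' mult.assoc
          mult.left_commute[of _ "cis t"] mult.left_commute[of _ "cnj (cis t)"] del: complex_cnj_cnj,
          simp_all add: ac_simps)
  qed
  moreover have "((\<lambda>i. (cmod (w i))\<^sup>2) has_sum 1) UNIV"
  proof -
    have "((\<lambda>n. (cmod (w (n, x, y)))\<^sup>2) has_sum 1 / 4) UNIV" for x y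
      using has_sum_cmult_left[OF g, of "1/4"] by (simp add: w_def power_divide norm_divide)
    from has_sum_bool_bool[OF this] show ?thesis by simp
  qed
  moreover have "((\<lambda>i. l1 i * w (p1 i) * cnj (w i)) has_sum of_real s) UNIV"
  proof -
    have "((\<lambda>n. l1 (n, x, y) * w (p1 (n, x, y)) * cnj (w (n, x, y))) has_sum
        (if x then if y then z * B / 4 else cnj (z * B) / 4
         else if y then cnj (z * of_real A) / 4 else z * of_real A / 4)) UNIV" for x y
      using fwd bwd mul adj by (cases x; cases y) (simp_all add: l1_def p1_def w_def)
    from has_sum_bool_bool[OF this] show ?thesis using mean by simp
  qed
  moreover have "((\<lambda>i. l2 i * w (p2 i) * cnj (w i)) has_sum of_real s) UNIV"
  proof -
    have "((\<lambda>n. l2 (n, x, y) * w (p2 (n, x, y)) * cnj (w (n, x, y))) has_sum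
        (if x then if y then cnj (z * of_real A) / 4 else z * of_real A / 4
         else if y then cnj (z * B) / 4 else z * B / 4)) UNIV" for x y
      using fwd bwd mul adj by (cases x; cases y) (simp_all add: l2_def p2_def w_def)
    from has_sum_bool_bool[OF this] show ?thesis using mean by (simp add: add_ac)
  qed
  ultimately have "intertwining_weights (cis \<theta>) (cis \<theta>') s p1 p2 l1 l2 w"
    unfolding intertwining_weights_def by blast
  then show ?thesis unfolding s_def t_def by blast
qed

section \<open>The dilation on sequences indexed by the natural numbers\<close>

theorem theorem3p2:
  fixes \<theta> \<theta>' c :: real and q q' :: complex
    and H :: "'a inner_space" and U V :: "'a \<Rightarrow> 'a"
  assumes "q = exp (\<i> * complex_of_real \<theta>)"
    and "q' = exp (\<i> * complex_of_real \<theta>')"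
    and "c = exp (1 / 4 * \<bar>\<theta> - \<theta>'\<bar>)"
    and "hilbert_space H"
    and "q_commuting_unitaries H q U V"
  shows "\<exists>(K :: (nat \<Rightarrow> 'a) inner_space) U' V'.
    hilbert_space K \<and> q_commuting_unitaries K q' U' V' \<and>
    dilates K (\<lambda>x. complex_of_real c \<odot>\<^bsub>K\<^esub> U' x) (\<lambda>x. complex_of_real c \<odot>\<^bsub>K\<^esub> V' x) H U V"
proof -
  interpret hilbert_space H by fact
  define s where "s = exp (- \<bar>\<theta> - \<theta>'\<bar> / 4)"
  have q: "q = cis \<theta>" "q' = cis \<theta>'" using assms(1,2) by (simp_all add: cis_conv_exp)
  have cs: "c * s = 1" unfolding assms(3) s_def by (simp flip: exp_add)
  \<comment> \<open>The dilation space has to consist of functions on \<open>nat\<close>, so the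
    countably infinite index type is enumerated.\<close>
  obtain e :: "nat \<Rightarrow> int \<times> bool \<times> bool" where e: "bij e"
    using bij_betw_from_nat_into[of "UNIV :: (int \<times> bool \<times> bool) set"]
    by (auto simp: finite_prod infinite_UNIV_int)
  obtain p1 p2 :: "nat \<Rightarrow> nat" and l1 l2 w where "intertwining_weights q q' s p1 p2 l1 l2 w"
    using intertwining_weights_gaussian[of \<theta> \<theta>'] intertwining_weights_transport[OF e]
    unfolding q s_def by blast
  then have "\<exists>U' V'. q_commuting_unitaries (ell2 H :: (nat \<Rightarrow> 'a) inner_space) q' U' V' \<and>
    dilates (ell2 H :: (nat \<Rightarrow> 'a) inner_space)
      (\<lambda>x. complex_of_real c \<odot>\<^bsub>ell2 H\<^esub> U' x) (\<lambda>x. complex_of_real c \<odot>\<^bsub>ell2 H\<^esub> V' x) H U V"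
    using assms(5) cs unfolding intertwining_weights_def
    by (intro dilation_by_weighted_shifts[of q U V p1 p2 l1 l2 q' w s c]) auto
  then show ?thesis using ell2_hilbert_space by blast
qed

end
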